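(* Let $X$ be a metric space with distance $d$ which is a Lebesgue space with its Borel $\sigma$-algebra. Let $\varphi:\mathbb{R}\times X\to X$ be a measurable flow preserving an ergodic probability measure $\mu$ and such that $\varphi_t:X\to X$ is a Lipschitz transformation for all $t\in\mathbb{R}$. Let $A:X\times\mathbb{R}\to GL(d,\mathbb{R})$ be a $\nu$-Hölder linear multiplicative cocycle over $\varphi$ such that $x\mapsto\sup_{t\in[-1,1]}\log^+\|A(x,t)\|$ is $\mu$-integrable. Denote by $\chi_1<\dots<\chi_k$ the $k$ distinct Lyapunov exponents of this cocycle, and by $E^i_x$ the Oseledets subspaces corresponding to $\chi_i$, $i=1,\dots,k$, which form a splitting $\mathbb{R}^d=E^1_x\oplus\dots\oplus E^k_x$ for $\mu$-almost every $x\in X$. Then, for every $\epsilon>0$, there exist a compact subset $\Lambda_\epsilon$ of $X$ and constants $C_\epsilon=C(\Lambda_\epsilon)>0$, $\omega_i=\omega_i(\chi_1,\dots,\chi_k)\in(0,1)$, $i=1,\dots,k$, and $\delta=\delta(\epsilon,A,\Lambda_\epsilon,\chi_1,\dots,\chi_k)>0$ such that (1) $\mu(\Lambda_\epsilon)\ge1-\epsilon$; (2) $\operatorname{dist}(E^i_x,E^i_y)\le C_\epsilon\, d(x,y)^{\nu\omega_i}$ for all $i=1,\dots,k$ and all $x,y\in\Lambda_\epsilon$ with $d(x,y)<\delta$.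
   Context: The letter $d$ denotes both the distance on $X$ and the dimension of $\mathbb{R}^d$. $\|\cdot\|$ is a Euclidean norm on $\mathbb{R}^d$ and the associated matrix norm; $\log^+(a)=\max\{\log a,0\}$. A measurable flow is a measurable map $\varphi:\mathbb{R}\times X\to X$, $\varphi_t=\varphi(t,\cdot)$, with $\varphi_0=\mathrm{Id}$ and $\varphi_t\circ\varphi_s=\varphi_{t+s}$; it preserves $\mu$ if every $\varphi_t$ does; $\mu$ is ergodic for $\varphi$ if every measurable $B$ with $\varphi_t(B)=B$ for all $t$ satisfies $\mu(B)\mu(X\setminus B)=0$. A linear multiplicative cocycle over $\varphi$ is a measurable $A:X\times\mathbb{R}\to GL(d,\mathbb{R})$ with $A(x,0)=\mathrm{Id}$ and $A(x,t+s)=A(\varphi_t(x),s)A(x,t)$ for all $x\in X$, $s,t\in\mathbb{R}$. It is $\nu$-Hölder if for every $t\in\mathbb{R}$ there is $H_t>0$ with $\|A(x,t)-A(y,t)\|\le H_t\,d(x,y)^\nu$ for all $x,y\in X$. By Oseledets' theorem and ergodicity there are numbers $\chi_1<\dots<\chi_k$ and, for $\mu$-a.e. $x$, a measurable splitting $\mathbb{R}^d=E^1_x\oplus\dots\oplus E^k_x$ with $A(x,t)E^i_x=E^i_{\varphi_t(x)}$ and $\lim_{t\to\pm\infty}\frac1t\log\|A(x,t)v\|=\chi_i$ for $0\ne v\in E^i_x$. Distance of subspaces: $\operatorname{dist}(v,E)=\min_{w\in E}\|v-w\|$ and $\operatorname{dist}(E,F)=\max\{\sup_{v\in E,\|v\|=1}\operatorname{dist}(v,F),\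 \sup_{v\in F,\|v\|=1}\operatorname{dist}(v,E)\}$. *)

theory Defs
  imports "HOL-Probability.Probability"
begin

section \<open>Lebesgue spaces\<close>

text \<open>Isomorphism mod 0: a bimeasurable, measure-preserving bijection between sets of full measure.
  It refers to the completed measures, as usual for Lebesgue spaces.\<close>

definition iso_mod_0 :: "'a measure \<Rightarrow> 'b measure \<Rightarrow> bool" where
  "iso_mod_0 M N \<longleftrightarrow>
    (\<exists>A\<in>null_sets (completion M). \<exists>B\<in>null_sets (completion N). \<exists>f g.
      let M' = restrict_space (completion M) (space M - A);
          N' = restrict_space (completion N) (space N - B)
      in f \<in> measurable M' N' \<and> g \<in> measurable N' M' \<and>
         (\<forall>x\<in>space M'. g (f x) = x) \<and> (\<forall>y\<in>space N'. f (g y) = y) \<and>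
         distr M' N' f = N')"

text \<open>Rokhlin: up to countably many point masses, an interval with Lebesgue measure. The interval
  may degenerate to a point, which is the purely atomic case.\<close>

definition lebesgue_space :: "'a measure \<Rightarrow> bool" where
  "lebesgue_space M \<longleftrightarrow>
    (\<exists>S s. countable S \<and> (\<forall>x\<in>S. {x} \<in> sets M) \<and> 0 \<le> s \<and>
       iso_mod_0 (restrict_space M (space M - S)) (restrict_space lborel {0..s::real}))"

section \<open>Flows\<close>

definition measurable_flow :: "'a measure \<Rightarrow> (real \<Rightarrow> 'a \<Rightarrow> 'a) \<Rightarrow> bool" where
  "measurable_flow M \<phi> \<longleftrightarrow>
    (\<lambda>(t, x). \<phi> t x) \<in> measurable (borel \<Otimes>\<^sub>M M) M \<and>
    (\<forall>x\<in>space M. \<phi> 0 x = x) \<and>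
    (\<forall>s t. \<forall>x\<in>space M. \<phi> t (\<phi> s x) = \<phi> (t + s) x)"

definition flow_invariant :: "'a measure \<Rightarrow> (real \<Rightarrow> 'a \<Rightarrow> 'a) \<Rightarrow> bool" where
  "flow_invariant M \<phi> \<longleftrightarrow> (\<forall>t. distr M M (\<phi> t) = M)"

definition flow_ergodic :: "'a measure \<Rightarrow> (real \<Rightarrow> 'a \<Rightarrow> 'a) \<Rightarrow> bool" where
  "flow_ergodic M \<phi> \<longleftrightarrow>
    (\<forall>B\<in>sets M. (\<forall>t. \<phi> t ` B = B) \<longrightarrow> measure M B * measure M (space M - B) = 0)"

section \<open>Linear cocycles\<close>

text \<open>The operator norm is needed explicitly: \<open>norm\<close> on \<open>real ^ 'n ^ 'n\<close> is the Frobenius norm.\<close>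

abbreviation matrix_norm :: "real ^ 'n ^ 'n \<Rightarrow> real" where
  "matrix_norm B \<equiv> onorm ((*v) B)"

definition log_plus :: "real \<Rightarrow> real" where
  "log_plus a = max (ln a) 0"

definition linear_cocycle ::
  "'a measure \<Rightarrow> (real \<Rightarrow> 'a \<Rightarrow> 'a) \<Rightarrow> ('a \<Rightarrow> real \<Rightarrow> real ^ 'n ^ 'n) \<Rightarrow> bool" where
  "linear_cocycle M \<phi> A \<longleftrightarrow>
    (\<lambda>(x, t). A x t) \<in> borel_measurable (M \<Otimes>\<^sub>M borel) \<and>
    (\<forall>x\<in>space M. \<forall>t. invertible (A x t)) \<and>
    (\<forall>x\<in>space M. A x 0 = mat 1) \<and>
    (\<forall>x\<in>space M. \<forall>s t. A x (t + s) = A (\<phi> t x) s ** A x t)"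

definition holder_cocycle ::
  "real \<Rightarrow> ('a::metric_space \<Rightarrow> real \<Rightarrow> real ^ 'n ^ 'n) \<Rightarrow> bool" where
  "holder_cocycle \<nu> A \<longleftrightarrow>
    (\<forall>t. \<exists>H>0. \<forall>x y. matrix_norm (A x t - A y t) \<le> H * dist x y powr \<nu>)"

text \<open>Integrability of the supremum of \<open>log_plus \<parallel>A(x,t)\<parallel>\<close> over \<open>t \<in> [-1,1]\<close>. The supremum is taken
  in \<open>ennreal\<close>, so that it is infinite when unbounded. Being over an uncountable set, it is only
  required to be measurable for the completed measure.\<close>

definition log_plus_integrable :: "'a measure \<Rightarrow> ('a \<Rightarrow> real \<Rightarrow> real ^ 'n ^ 'n) \<Rightarrow> bool" where
  "log_plus_integrable M A \<longleftrightarrow>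
    (\<lambda>x. SUP t\<in>{-1..1}. ennreal (log_plus (matrix_norm (A x t))))
      \<in> borel_measurable (completion M) \<and>
    (\<integral>\<^sup>+ x. (SUP t\<in>{-1..1}. ennreal (log_plus (matrix_norm (A x t)))) \<partial>completion M) < \<infinity>"

section \<open>Oseledets splitting\<close>

definition direct_sum_splitting :: "nat \<Rightarrow> (nat \<Rightarrow> (real ^ 'n) set) \<Rightarrow> bool" where
  "direct_sum_splitting k V \<longleftrightarrow>
    (\<forall>i<k. subspace (V i)) \<and>
    (\<forall>v. \<exists>!w. w \<in> (\<Pi>\<^sub>E i\<in>{..<k}. V i) \<and> (\<Sum>i<k. w i) = v)"

text \<open>The exponents are listed in increasing order in \<open>\<chi>s\<close>, and indices start at 0. The subspaces are
  nonzero since every entry of \<open>\<chi>s\<close> is a Lyapunov exponent. Measurability of a family of subspaces is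
  expressed by its distance functions; the completion makes it insensitive to null sets, outside of
  which alone the splitting is determined.\<close>

definition oseledets_splitting ::
  "'a measure \<Rightarrow> (real \<Rightarrow> 'a \<Rightarrow> 'a) \<Rightarrow> ('a \<Rightarrow> real \<Rightarrow> real ^ 'n ^ 'n) \<Rightarrow>
   real list \<Rightarrow> (nat \<Rightarrow> 'a \<Rightarrow> (real ^ 'n) set) \<Rightarrow> bool" where
  "oseledets_splitting M \<phi> A \<chi>s E \<longleftrightarrow>
    sorted_wrt (<) \<chi>s \<and>
    (\<forall>i<length \<chi>s. \<forall>v. (\<lambda>x. infdist v (E i x)) \<in> borel_measurable (completion M)) \<and>
    (AE x in M.
       direct_sum_splitting (length \<chi>s) (\<lambda>i. E i x) \<and>
       (\<forall>i<length \<chi>s.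
          E i x \<noteq> {0} \<and>
          (\<forall>t. (*v) (A x t) ` E i x = E i (\<phi> t x)) \<and>
          (\<forall>v\<in>E i x - {0}.
             ((\<lambda>t. 1 / t * ln (norm (A x t *v v))) \<longlongrightarrow> \<chi>s ! i) at_top \<and>
             ((\<lambda>t. 1 / t * ln (norm (A x t *v v))) \<longlongrightarrow> \<chi>s ! i) at_bot)))"

section \<open>Distance between subspaces\<close>

text \<open>Only meaningful for nonzero subspaces: the unit sphere of \<open>{0}\<close> is empty, and so its supremum
  unspecified.\<close>

definition subspace_dist :: "(real ^ 'n) set \<Rightarrow> (real ^ 'n) set \<Rightarrow> real" where
  "subspace_dist V W =
    max (SUP v\<in>{v\<in>V. norm v = 1}. infdist v W) (SUP v\<in>{v\<in>W. norm v = 1}. infdist v V)"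

end

theory Submission imports Defs begin

text \<open>Decompose a unit vector \<open>v\<close> of \<open>E i y\<close> along the splitting at \<open>x\<close>. If \<open>x\<close> and its image at an
  integer time \<open>n\<close> are uniformly regular, the component of \<open>v\<close> in \<open>E j x\<close> is at most a constant times
  \<open>exp (- \<chi>\<^sub>j n) \<parallel>A(x,n) v\<parallel>\<close> up to subexponential factors, and \<open>A(x,n) v\<close> differs from \<open>A(y,n) v\<close>, which has
  size \<open>exp (\<chi>\<^sub>i n)\<close>, by at most \<open>exp (a n) d(x,y)\<^sup>\<nu>\<close>. Balancing the two terms with \<open>n\<close> proportional to
  \<open>- ln d(x,y)\<close> gives a power of \<open>d(x,y)\<close> if \<open>\<chi>\<^sub>j > \<chi>\<^sub>i\<close>; reversing time treats \<open>\<chi>\<^sub>j < \<chi>\<^sub>i\<close>.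
  By the maximal ergodic inequality, for most \<open>x\<close> the orbit is so rarely non-regular that
  every window \<open>{N..2 N}\<close> contains a usable time \<open>n\<close>, and that the rate \<open>a\<close> depends only on the exponents,
  on \<open>\<nu>\<close> and on the Lipschitz constants of the flow.

  As \<open>X\<close> need be neither complete nor separable, the compact set comes from Lusin's theorem for the
  isomorphism of \<open>X\<close> with an interval. Lusin's theorem holds without separability, because
  a partition into null sets with all unions measurable has a null union.\<close>

section \<open>Compact sets in Lebesgue spaces\<close>

text \<open>The cocycle need not be bounded: only the positive part of its logarithmic norm is
  integrable, and the points that an orbit meets between two regular times carry no uniform bound.
  Still, the rate of growth from such a point must be known before \<open>A\<close>, since the
  Hoelder exponent is chosen before the cocycle. So every visit outside of a large regular set is
  charged at least the logarithm of the next step, and the set is taken so large that for most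
  starting points the charge up to time n stays below n / 2. The constants of regularity, which do
  depend on \<open>A\<close> and on the set, only multiply the estimate and never enter the rate. In
  Lusin's theorem, a Borel map into a nonseparable space is first replaced by a discretized one at
  uniformly small distance, all of whose preimages are measurable; the theorem on partitions then
  leaves countably many values up to a null set.\<close>

lemma sigma_finite_completion:
  assumes "sigma_finite_measure M"
  shows "sigma_finite_measure (completion M)"
proof -
  obtain A where "countable A" "A \<subseteq> sets M" "\<Union>A = space M" "\<forall>a\<in>A. emeasure M a \<noteq> \<infinity>"
    using sigma_finite_measure.sigma_finite_countable[OF assms] by blast
  then show ?thesis
    by (intro sigma_finite_measure.intro exI[of _ A]) (auto simp: subset_iff)
qed

text \<open>Sierpinski's use of Fubini for an order relation. The relation
  \<open>(h s, h t) \<in> r\<close> may fail to be measurable in the product, so each initial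
  segment is first enlarged to a null countable intersection of open sets; Fubini is applied to the
  enlarged relation \<open>Z\<close>.\<close>

lemma null_if_initial_segments_null:
  fixes h :: "'a::euclidean_space \<Rightarrow> 'i"
  assumes meas: "\<And>J. T \<inter> h -` J \<in> sets lebesgue"
    and total: "\<And>i j. (i, j) \<in> r \<or> (j, i) \<in> r"
    and null: "\<And>i. i \<in> h ` T \<Longrightarrow> T \<inter> h -` {j. (j, i) \<in> r} \<in> null_sets lebesgue"
  shows "T \<in> null_sets lebesgue"
proof -
  have T: "T \<in> sets lebesgue"
    using meas[of UNIV] by simp
  have "\<exists>U. open U \<and> T \<inter> h -` {j. (j, i) \<in> r} \<subseteq> U \<and> emeasure lebesgue U \<le> ennreal (1 / Suc n)"
    if i: "i \<in> h ` T" for i and n :: nat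
  proof -
    let ?S = "T \<inter> h -` {j. (j, i) \<in> r}"
    obtain U where U: "open U" "?S \<subseteq> U" "U - ?S \<in> lmeasurable"
      "emeasure lebesgue (U - ?S) < ennreal (1 / Suc n)"
      by (rule sets_lebesgue_outer_open[OF meas[of "{j. (j, i) \<in> r}"], of "1 / Suc n"]) simp
    have "emeasure lebesgue (U - ?S) = emeasure lebesgue U"
      using null[OF i] U(1) by (intro emeasure_Diff_null_set) auto
    with U show ?thesis
      by (metis less_imp_le)
  qed
  then have "\<exists>U. open U \<and> (i \<in> h ` T \<longrightarrow> T \<inter> h -` {j. (j, i) \<in> r} \<subseteq> U \<and>
      emeasure lebesgue U \<le> ennreal (1 / Suc n))" for i and n :: nat
    by (metis open_UNIV)
  then obtain U where U: "\<And>i n. open (U i n)"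
    "\<And>i n. i \<in> h ` T \<Longrightarrow> T \<inter> h -` {j. (j, i) \<in> r} \<subseteq> U i n"
    "\<And>i n. i \<in> h ` T \<Longrightarrow> emeasure lebesgue (U i n) \<le> ennreal (1 / Suc n)"
    by metis
  obtain B :: "'a set set" where B: "countable B" "topological_basis B"
    using ex_countable_basis by blast
  \<comment> \<open>A countable base turns \<open>s \<in> U (h t) n\<close> into a countable union
    of rectangles. Their second sides are measurable because all unions of fibres are.\<close>
  define Z where "Z = (\<Inter>n. \<Union>b\<in>B. (T \<inter> b) \<times> (T \<inter> h -` {i. b \<subseteq> U i n}))"
  have Z_eq: "Z = {(s, t). s \<in> T \<and> t \<in> T \<and> (\<forall>n. s \<in> U (h t) n)}"
  proof (intro equalityI subrelI)
    fix s t assume "(s, t) \<in> Z"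
    then show "(s, t) \<in> {(s, t). s \<in> T \<and> t \<in> T \<and> (\<forall>n. s \<in> U (h t) n)}"
      unfolding Z_def by blast
  next
    fix s t assume "(s, t) \<in> {(s, t). s \<in> T \<and> t \<in> T \<and> (\<forall>n. s \<in> U (h t) n)}"
    then have st: "s \<in> T" "t \<in> T" "\<forall>n. s \<in> U (h t) n"
      by auto
    have "\<exists>b\<in>B. s \<in> b \<and> b \<subseteq> U (h t) n" for n
      using topological_basisE[OF B(2) U(1)] st(3) by metis
    with st show "(s, t) \<in> Z"
      unfolding Z_def by blast
  qed
  have "(T \<inter> b) \<times> (T \<inter> h -` {i. b \<subseteq> U i n}) \<in> sets (lebesgue \<Otimes>\<^sub>M lebesgue)"
    if "b \<in> B" for b n
  proof (rule pair_measureI[OF _ meas])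
    show "T \<inter> b \<in> sets lebesgue"
      using that T B(2) by (auto simp: topological_basis_open)
  qed
  then have Z: "Z \<in> sets (lebesgue \<Otimes>\<^sub>M lebesgue)"
    unfolding Z_def using B(1)
    by (intro sets.countable_INT image_subsetI sets.countable_UN') auto
  interpret L: sigma_finite_measure "lebesgue :: 'a measure"
    by (intro sigma_finite_completion lborel.sigma_finite_measure_axioms)
  interpret pair_sigma_finite "lebesgue :: 'a measure" "lebesgue :: 'a measure" ..
  have "emeasure lebesgue ((\<lambda>s. (s, t)) -` Z) = 0" for t
  proof (cases "t \<in> T")
    case False
    then have "(\<lambda>s. (s, t)) -` Z = {}"
      by (auto simp: Z_eq)
    then show ?thesis
      by simp
  next
    case t: True
    have "emeasure lebesgue ((\<lambda>s. (s, t)) -` Z) \<le> ennreal (1 / Suc n)" for n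
    proof -
      have "emeasure lebesgue ((\<lambda>s. (s, t)) -` Z) \<le> emeasure lebesgue (U (h t) n)"
        using U(1) by (intro emeasure_mono) (auto simp: Z_eq)
      with U(3)[of "h t" n] t show ?thesis
        by (meson image_eqI order_trans)
    qed
    moreover have "(\<lambda>n. ennreal (1 / Suc n)) \<longlonglongrightarrow> ennreal 0"
      by (intro tendsto_ennrealI LIMSEQ_Suc lim_1_over_n)
    ultimately show ?thesis
      using LIMSEQ_le_const[of "\<lambda>n. ennreal (1 / Suc n)" "ennreal 0"] by fastforce
  qed
  then have Z0: "emeasure (lebesgue \<Otimes>\<^sub>M lebesgue) Z = 0"
    by (simp add: emeasure_pair_measure_alt2[OF Z])
  \<comment> \<open>By totality, a point \<open>t\<close> of \<open>T\<close> lies in the initial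
    segment of \<open>h s\<close>, which is null, or satisfies \<open>(s, t) \<in> Z\<close>. So
    almost all of \<open>T\<close> lies in the section, and integrating over \<open>T\<close>
    squares its measure.\<close>
  have "emeasure lebesgue T \<le> emeasure lebesgue (Pair s -` Z)" if "s \<in> T" for s
  proof -
    have "emeasure lebesgue T = emeasure lebesgue (T - T \<inter> h -` {j. (j, h s) \<in> r})"
      using null[of "h s"] that T by (intro emeasure_Diff_null_set[symmetric]) auto
    also have "\<dots> \<le> emeasure lebesgue (Pair s -` Z)"
    proof (intro emeasure_mono subsetI sets_Pair1[OF Z])
      fix t assume t: "t \<in> T - T \<inter> h -` {j. (j, h s) \<in> r}"
      then have "s \<in> T \<inter> h -` {j. (j, h t) \<in> r}"
        using that total by blast
      with t that show "t \<in> Pair s -` Z"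
        using U(2) by (auto simp: Z_eq)
    qed
    finally show ?thesis .
  qed
  then have "(\<integral>\<^sup>+s. emeasure lebesgue T * indicator T s \<partial>lebesgue) \<le> (\<integral>\<^sup>+s. emeasure lebesgue (Pair s -` Z) \<partial>lebesgue)"
    by (intro nn_integral_mono) (auto simp: indicator_def)
  also have "\<dots> = 0"
    using Z0 by (simp add: L.emeasure_pair_measure_alt[OF Z])
  finally show ?thesis
    using T by (simp add: nn_integral_cmult_indicator null_setsI)
qed

text \<open>The case of a partition of the theorem of Brzuchowski, Cichon, Grzegorek and
  Ryll-Nardzewski.\<close>

lemma null_if_fibres_null:
  fixes h :: "'a::euclidean_space \<Rightarrow> 'i"
  assumes meas: "\<And>J. T \<inter> h -` J \<in> sets lebesgue"
    and null: "\<And>i. T \<inter> h -` {i} \<in> null_sets lebesgue"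
  shows "T \<in> null_sets lebesgue"
proof -
  obtain r :: "'i rel" where r: "well_order_on UNIV r"
    using well_order_on by blast
  have wf: "wf (r - Id)"
    using r by (simp add: well_order_on_def)
  have total: "(i, j) \<in> r \<or> (j, i) \<in> r" for i j
    using r by (metis UNIV_I linear_order_on_def order_on_defs(1) partial_order_on_def
        preorder_on_def refl_on_def total_on_def well_order_on_def)
  \<comment> \<open>Transfinite induction: inside a strict initial segment, the closed segment below
    \<open>k\<close> consists of a shorter strict segment and one fibre, both null, so the previous
    lemma applies.\<close>
  have ini: "T \<inter> h -` {j. (j, i) \<in> r - Id} \<in> null_sets lebesgue" for i
  proof (induction i rule: wf_induct_rule[OF wf])
    case (1 i)
    let ?T = "T \<inter> h -` {j. (j, i) \<in> r - Id}"
    show ?case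
    proof (rule null_if_initial_segments_null[OF _ total])
      show "?T \<inter> h -` J \<in> sets lebesgue" for J
        using meas[of "{j. (j, i) \<in> r - Id} \<inter> J"] by (simp add: Int_assoc vimage_Int)
      fix k assume "k \<in> h ` ?T"
      then have "T \<inter> h -` {j. (j, k) \<in> r - Id} \<union> T \<inter> h -` {k} \<in> null_sets lebesgue"
        using 1 null by (intro null_sets.Un) auto
      moreover have "?T \<inter> h -` {j. (j, k) \<in> r} \<in> sets lebesgue"
        using meas[of "{j. (j, i) \<in> r - Id} \<inter> {j. (j, k) \<in> r}"]
        by (simp add: Int_assoc vimage_Int)
      ultimately show "?T \<inter> h -` {j. (j, k) \<in> r} \<in> null_sets lebesgue"
        by (rule null_sets_subset) auto
    qed
  qed
  show ?thesis
  proof (rule null_if_initial_segments_null[OF meas total])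
    fix k
    have "T \<inter> h -` {j. (j, k) \<in> r - Id} \<union> T \<inter> h -` {k} \<in> null_sets lebesgue"
      using ini null by (intro null_sets.Un)
    then show "T \<inter> h -` {j. (j, k) \<in> r} \<in> null_sets lebesgue"
      by (rule null_sets_subset[OF _ meas]) auto
  qed
qed

text \<open>The image measure is finite, so only countably many fibres have positive measure. The
  others are null one by one, and the preceding lemma makes their possibly uncountable union
  null.\<close>

lemma countable_fibres:
  fixes h :: "'a::euclidean_space \<Rightarrow> 'i"
  assumes meas: "\<And>J. T \<inter> h -` J \<in> sets lebesgue"
    and fin: "emeasure lebesgue T < \<infinity>"
  obtains J where "countable J" "T \<inter> h -` (- J) \<in> null_sets lebesgue"
proof -
  have T: "T \<in> sets lebesgue"
    using meas[of UNIV] by simp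
  let ?M = "restrict_space lebesgue T"
  let ?D = "distr ?M (count_space UNIV) h"
  have h: "h \<in> measurable ?M (count_space UNIV)"
    using meas T by (auto simp: measurable_def sets_restrict_space_iff space_restrict_space Int_commute)
  interpret M: finite_measure ?M
    using fin T by (intro finite_measureI) (simp add: space_restrict_space emeasure_restrict_space)
  interpret D: finite_measure ?D
    by (rule M.finite_measure_distr[OF h])
  let ?J = "{i. measure ?D {i} \<noteq> 0}"
  have null: "T \<inter> h -` {i} \<in> null_sets lebesgue" if "i \<notin> ?J" for i
  proof -
    have "measure ?D {i} = 0"
      using that by simp
    then have "emeasure ?D {i} = 0"
      by (simp add: D.emeasure_eq_measure)
    also have "emeasure ?D {i} = emeasure lebesgue (T \<inter> h -` {i})"
      using T meas by (subst emeasure_distr[OF h])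
        (auto simp: space_restrict_space emeasure_restrict_space Int_commute simp del: emeasure_completion)
    finally show ?thesis
      using meas by (simp add: null_sets_def del: emeasure_completion)
  qed
  have "T \<inter> h -` (- ?J) \<in> null_sets lebesgue"
  proof (rule null_if_fibres_null[where h = h])
    show "T \<inter> h -` (- ?J) \<inter> h -` K \<in> sets lebesgue" for K
      using meas[of "- ?J \<inter> K"] by (simp add: Int_assoc vimage_Int)
    show "T \<inter> h -` (- ?J) \<inter> h -` {i} \<in> null_sets lebesgue" for i
    proof (cases "i \<in> ?J")
      case True
      then have "T \<inter> h -` (- ?J) \<inter> h -` {i} = {}"
        by auto
      then show ?thesis
        by simp
    next
      case False
      then have "T \<inter> h -` (- ?J) \<inter> h -` {i} = T \<inter> h -` {i}"
        by auto
      then show ?thesis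
        using null[OF False] by simp
    qed
  qed
  then show ?thesis
    using that D.countable_support by blast
qed

text \<open>Stone's shrinking of the first-index partition of a cover by balls: shrunk pieces have positive
  mutual distance, so that arbitrary unions of them are closed.\<close>

lemma borel_approximation_arbitrary_preimages:
  assumes "0 < r"
  obtains p :: "'a::metric_space \<Rightarrow> 'a"
  where "\<And>x. dist (p x) x < r" "\<And>J. p -` J \<in> sets borel"
proof -
  obtain R :: "'a rel" where R: "well_order_on UNIV R"
    using well_order_on by blast
  have wf: "wf (R - Id)"
    using R by (simp add: well_order_on_def)
  have total: "(i, j) \<in> R - Id \<or> (j, i) \<in> R - Id" if "i \<noteq> j" for i j
    using R that by (auto simp: well_order_on_def linear_order_on_def total_on_def)
  \<comment> \<open>Every point serves as a centre; well-foundedness picks the first one whose ball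
    contains \<open>x\<close>.\<close>
  have "\<exists>a. dist a x < r \<and> (\<forall>b. (b, a) \<in> R - Id \<longrightarrow> r \<le> dist b x)" for x
    using wfE_min[OF wf, of x "{a. dist a x < r}"] assms by (metis dist_self mem_Collect_eq not_le)
  then obtain p where p: "\<And>x. dist (p x) x < r" "\<And>x b. (b, p x) \<in> R - Id \<Longrightarrow> r \<le> dist b x"
    by metis
  \<comment> \<open>The shrunk piece stays at distance 1 / (n + 1) from the complement of the ball
    around \<open>a\<close>. Later pieces lie in that complement, which separates the
    \<open>V a n\<close> for fixed \<open>n\<close>.\<close>
  define V where "V a n = {y. (\<forall>b. (b, a) \<in> R - Id \<longrightarrow> r \<le> dist b y) \<and>
      (\<forall>z. r \<le> dist a z \<longrightarrow> 1 / real (Suc n) \<le> dist y z)}" for a n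
  have V_closed: "closed (V a n)" for a n
    unfolding V_def by (intro closed_Collect_conj closed_Collect_all closed_Collect_imp
        open_Collect_const closed_Collect_le continuous_intros)
  have V_sep: "1 / real (Suc n) \<le> dist y z" if "y \<in> V a n" "z \<in> V b n" "a \<noteq> b" for y z a b n
    using total[OF that(3)]
  proof
    assume "(a, b) \<in> R - Id"
    then show ?thesis
      using that(1,2) unfolding V_def by blast
  next
    assume "(b, a) \<in> R - Id"
    then have "1 / real (Suc n) \<le> dist z y"
      using that(1,2) unfolding V_def by blast
    then show ?thesis
      by (simp add: dist_commute)
  qed
  have cl: "closed (\<Union>a\<in>J. V a n)" for J n
  proof -
    have "y \<in> (\<Union>a\<in>J. V a n)" if y: "y \<in> closure (\<Union>a\<in>J. V a n)" for y
    proof -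
      \<comment> \<open>With half the separation, two points closer than \<open>e\<close> to
        \<open>y\<close> cannot lie in different pieces, so only one piece accumulates at
        \<open>y\<close>.\<close>
      define e where "e = 1 / (2 * real (Suc n))"
      have e: "0 < e" "e + e = 1 / real (Suc n)"
        by (auto simp: e_def field_simps)
      obtain y1 a where y1: "a \<in> J" "y1 \<in> V a n" "dist y1 y < e"
        using y e(1) unfolding closure_approachable by blast
      have "y \<in> closure (V a n)"
        unfolding closure_approachable
      proof (intro allI impI)
        fix \<delta> :: real assume "0 < \<delta>"
        then obtain y2 b where y2: "b \<in> J" "y2 \<in> V b n" "dist y2 y < min \<delta> e"
          using y e(1) unfolding closure_approachable
          by (metis (no_types, lifting) UN_iff min_less_iff_conj)
        have "dist y1 y2 < 1 / real (Suc n)"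
          using y1(3) y2(3) e(2) dist_triangle_less_add[of y1 y e y2 e] by (simp add: dist_commute)
        then have "a = b"
          using V_sep[OF y1(2) y2(2)] by fastforce
        with y2 show "\<exists>y'\<in>V a n. dist y' y < \<delta>"
          by auto
      qed
      with V_closed y1(1) show ?thesis
        by auto
    qed
    then show ?thesis
      using closure_subset_eq by blast
  qed
  have p_iff: "(\<exists>n. x \<in> V a n) \<longleftrightarrow> p x = a" for x a
  proof
    assume "\<exists>n. x \<in> V a n"
    then obtain n where n: "x \<in> V a n" ..
    then have "dist a x < r"
      unfolding V_def by (metis (mono_tags, lifting) dist_self divide_pos_pos mem_Collect_eq not_le
          of_nat_0_less_iff zero_less_Suc zero_less_one)
    then have "(a, p x) \<notin> R - Id"
      using p(2) by fastforce
    moreover have "(p x, a) \<notin> R - Id"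
      using p(1)[of x] n unfolding V_def by fastforce
    ultimately show "p x = a"
      using total by blast
  next
    assume px: "p x = a"
    define e where "e = r - dist a x"
    have e: "0 < e"
      using p(1)[of x] px by (simp add: e_def)
    have e_ball: "dist a z < r" if "dist z x < e" for z
      using that dist_triangle[of a z x] by (simp add: e_def dist_commute)
    obtain n where n: "1 / real (Suc n) < e"
      using e nat_approx_posE by blast
    have "x \<in> V a n"
      unfolding V_def
    proof (intro CollectI conjI allI impI)
      show "r \<le> dist b x" if "(b, a) \<in> R - Id" for b
        using that px p(2) by blast
      show "1 / real (Suc n) \<le> dist x z" if "r \<le> dist a z" for z
        using that e_ball[of z] n by (fastforce simp: dist_commute)
    qed
    then show "\<exists>n. x \<in> V a n" ..
  qed
  have "p -` J = (\<Union>n. \<Union>a\<in>J. V a n)" for J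
    using p_iff by blast
  then have "p -` J \<in> sets borel" for J
    using cl by (auto intro!: sets.countable_UN borel_closed)
  with p(1) that show ?thesis
    by blast
qed


section \<open>Lusin's theorem with values in a metric space\<close>

lemma (in finite_measure) measure_UN_finite_approx:
  assumes J: "countable J" and F: "\<And>i. i \<in> J \<Longrightarrow> F i \<in> sets M" and e: "0 < e"
  obtains P where "finite P" "P \<subseteq> J" "measure M (\<Union>i\<in>J. F i) < measure M (\<Union>i\<in>P. F i) + e"
proof (cases "J = {}")
  case True
  with that[of "{}"] e show ?thesis
    by simp
next
  case False
  let ?P = "\<lambda>n::nat. from_nat_into J ` {..<n}"
  have PJ: "?P n \<subseteq> J" for n
    using False by (auto intro: from_nat_into)
  have "(\<lambda>n. measure M (\<Union>i\<in>?P n. F i)) \<longlonglongrightarrow> measure M (\<Union>n. \<Union>i\<in>?P n. F i)"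
  proof (rule finite_Lim_measure_incseq)
    show "range (\<lambda>n. \<Union>i\<in>?P n. F i) \<subseteq> sets M"
      using PJ F by (intro image_subsetI sets.finite_UN) auto
    show "incseq (\<lambda>n. \<Union>i\<in>?P n. F i)"
      by (rule incseq_SucI) (auto simp: less_Suc_eq)
  qed
  also have "(\<Union>n. \<Union>i\<in>?P n. F i) = (\<Union>i\<in>J. F i)"
  proof (intro equalityI subsetI)
    fix x assume "x \<in> (\<Union>i\<in>J. F i)"
    then obtain n where "x \<in> F (from_nat_into J n)"
      using from_nat_into_surj[OF J] by blast
    then show "x \<in> (\<Union>n. \<Union>i\<in>?P n. F i)"
      by (intro UN_I[of "Suc n"]) auto
  qed (use PJ in blast)
  finally have "eventually (\<lambda>n. measure M (\<Union>i\<in>J. F i) - e < measure M (\<Union>i\<in>?P n. F i)) sequentially"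
    using e by (intro order_tendstoD) auto
  then obtain n where "measure M (\<Union>i\<in>J. F i) - e < measure M (\<Union>i\<in>?P n. F i)"
    by (auto simp: eventually_sequentially)
  with that[of "?P n"] PJ show ?thesis
    by simp
qed

text \<open>A discretization at scale r / 2 has countably many values up to a null set, and finitely
  many up to small measure. On a finite union of compact sets, one in each remaining fibre, it is
  locally constant, so \<open>g\<close> oscillates by less than \<open>r\<close>.\<close>

lemma lusin_oscillation:
  fixes g :: "'a::euclidean_space \<Rightarrow> 'b::metric_space"
  assumes meas: "\<And>B. B \<in> sets borel \<Longrightarrow> T \<inter> g -` B \<in> sets lebesgue"
    and T: "bounded T" and r: "0 < r" and e: "0 < e"
  obtains K where "compact K" "K \<subseteq> T" "emeasure lebesgue (T - K) \<le> ennreal e"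
    "\<And>x. x \<in> K \<Longrightarrow> \<exists>d>0. \<forall>y\<in>K. dist y x < d \<longrightarrow> dist (g y) (g x) < r"
proof -
  obtain p :: "'b \<Rightarrow> 'b" where p: "\<And>x. dist (p x) x < r / 2" "\<And>J. p -` J \<in> sets borel"
    using borel_approximation_arbitrary_preimages[of "r / 2"] r by auto
  define h where "h = p \<circ> g"
  have h: "T \<inter> h -` J \<in> sets lebesgue" for J
    using meas[OF p(2)] by (simp add: h_def vimage_comp)
  have Tm: "T \<in> lmeasurable"
    using meas[of UNIV] T by (simp add: bounded_set_imp_lmeasurable)
  then have fin: "emeasure lebesgue T < \<infinity>"
    by (simp add: fmeasurable_def del: emeasure_completion)
  obtain J where J: "countable J" "T \<inter> h -` (- J) \<in> null_sets lebesgue"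
    using countable_fibres[OF h fin] .
  have TJ: "T \<inter> h -` P \<in> lmeasurable" for P
    using h T by (meson Int_lower1 bounded_set_imp_lmeasurable bounded_subset)
  interpret M: finite_measure "restrict_space lebesgue T"
    using fin meas[of UNIV] by (intro finite_measureI)
      (simp add: space_restrict_space emeasure_restrict_space del: emeasure_completion)
  obtain P where P: "finite P" "P \<subseteq> J"
    "measure (restrict_space lebesgue T) (\<Union>i\<in>J. T \<inter> h -` {i}) <
      measure (restrict_space lebesgue T) (\<Union>i\<in>P. T \<inter> h -` {i}) + e / 2"
    using M.measure_UN_finite_approx[OF J(1), of "\<lambda>i. T \<inter> h -` {i}" "e / 2"] h e meas[of UNIV]
    by (auto simp: sets_restrict_space_iff)
  have meas_UN: "measure (restrict_space lebesgue T) (\<Union>i\<in>P. T \<inter> h -` {i}) = measure lebesgue (T \<inter> h -` P)" for P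
  proof -
    have "(\<Union>i\<in>P. T \<inter> h -` {i}) = T \<inter> h -` P"
      by auto
    then show ?thesis
      using meas[of UNIV] h by (simp add: measure_restrict_space del: measure_completion)
  qed
  have "measure lebesgue (T - T \<inter> h -` P) \<le> e / 2"
  proof -
    have "measure lebesgue T = measure lebesgue (T - T \<inter> h -` (- J))"
      using J(2) meas[of UNIV] by (intro measure_Diff_null_set[symmetric]) auto
    also have "T - T \<inter> h -` (- J) = T \<inter> h -` J"
      by auto
    finally show ?thesis
      using P(3) meas_UN TJ Tm by (simp add: measurable_measure_Diff fmeasurableD del: measure_completion)
  qed
  then have P_em: "emeasure lebesgue (T - T \<inter> h -` P) \<le> ennreal (e / 2)"
    using Tm TJ by (simp add: emeasure_eq_measure2 fmeasurable_Diff fmeasurableD ennreal_leI del: emeasure_completion measure_completion)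
  \<comment> \<open>Half of \<open>e\<close> goes to the discarded fibres, half to the inner
    approximations. \<open>Suc\<close> keeps \<open>d\<close> positive for empty \<open>P\<close>,
    where division by zero would give 0.\<close>
  define d where "d = e / (2 * real (Suc (card P)))"
  have d: "0 < d"
    using e by (simp add: d_def)
  have "\<exists>K. closed K \<and> K \<subseteq> T \<inter> h -` {i} \<and> emeasure lebesgue (T \<inter> h -` {i} - K) \<le> ennreal d" for i
    by (rule sets_lebesgue_inner_closed[OF h[of "{i}"] d]) (meson less_imp_le)
  then obtain K where K: "\<And>i. closed (K i)" "\<And>i. K i \<subseteq> T \<inter> h -` {i}"
    "\<And>i. emeasure lebesgue (T \<inter> h -` {i} - K i) \<le> ennreal d"
    by metis
  have Kc: "compact (K i)" for i
    using K(1,2) T by (meson Int_subset_iff bounded_subset compact_eq_bounded_closed)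
  show ?thesis
  proof (rule that)
    show "compact (\<Union>i\<in>P. K i)"
      using P(1) Kc by (intro compact_UN) auto
    show "(\<Union>i\<in>P. K i) \<subseteq> T"
      using K(2) by blast
    have "emeasure lebesgue (T - (\<Union>i\<in>P. K i)) \<le>
      emeasure lebesgue ((T - T \<inter> h -` P) \<union> (\<Union>i\<in>P. T \<inter> h -` {i} - K i))"
      using h meas[of UNIV] K(1) P(1)
      by (intro emeasure_mono sets.Un sets.Diff sets.finite_UN) (auto intro: borel_closed simp del: vimage_Collect_eq)
    also have "\<dots> \<le> emeasure lebesgue (T - T \<inter> h -` P) + emeasure lebesgue (\<Union>i\<in>P. T \<inter> h -` {i} - K i)"
      using h meas[of UNIV] K(1) P(1)
      by (intro emeasure_subadditive sets.Un sets.Diff sets.finite_UN) (auto intro: borel_closed)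
    also have "emeasure lebesgue (\<Union>i\<in>P. T \<inter> h -` {i} - K i) \<le> (\<Sum>i\<in>P. emeasure lebesgue (T \<inter> h -` {i} - K i))"
      using h K(1) P(1) by (intro emeasure_subadditive_finite) (auto intro!: sets.Diff borel_closed)
    also have "\<dots> \<le> (\<Sum>i\<in>P. ennreal d)"
      using K(3) by (rule sum_mono)
    also have "\<dots> = ennreal (card P * d)"
      using d by (simp add: ennreal_mult' ennreal_of_nat_eq_real_of_nat)
    also have "\<dots> \<le> ennreal (e / 2)"
      using e by (intro ennreal_leI) (simp add: d_def field_simps)
    also note P_em
    also have "ennreal (e / 2) + ennreal (e / 2) = ennreal e"
      using e by (simp flip: ennreal_plus)
    finally show "emeasure lebesgue (T - (\<Union>i\<in>P. K i)) \<le> ennreal e"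
      by (simp del: emeasure_completion add: add_right_mono add_left_mono)
    fix x assume "x \<in> (\<Union>i\<in>P. K i)"
    then obtain i where i: "i \<in> P" "x \<in> K i"
      by blast
    have "open (- (\<Union>j\<in>P - {i}. K j))"
      using P(1) K(1) by (intro open_Compl closed_UN) auto
    moreover have "x \<in> - (\<Union>j\<in>P - {i}. K j)"
      using i K(2) by blast
    ultimately obtain \<delta> where \<delta>: "0 < \<delta>" "\<And>y. dist y x < \<delta> \<Longrightarrow> y \<in> - (\<Union>j\<in>P - {i}. K j)"
      unfolding open_dist by metis
    have "dist (g y) (g x) < r" if "y \<in> (\<Union>i\<in>P. K i)" "dist y x < \<delta>" for y
    proof -
      have "y \<in> K i"
        using that \<delta>(2)[OF that(2)] by blast
      then have "h y = i" "h x = i"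
        using K(2) i(2) by blast+
      then have "p (g y) = p (g x)"
        by (simp add: h_def)
      then show ?thesis
        using p(1)[of "g x"] p(1)[of "g y"] dist_triangle_half_r[of "p (g x)" "g y" r "g x"] by (simp add: dist_commute)
    qed
    with \<delta>(1) show "\<exists>d>0. \<forall>y\<in>(\<Union>i\<in>P. K i). dist y x < d \<longrightarrow> dist (g y) (g x) < r"
      by blast
  qed
qed

text \<open>The compact sets of the preceding lemma for oscillations 1 / (n + 1) are intersected;
  the losses e / 2 ^ (n + 1) sum to \<open>e\<close>.\<close>

lemma lusin:
  fixes g :: "'a::euclidean_space \<Rightarrow> 'b::metric_space"
  assumes meas: "\<And>B. B \<in> sets borel \<Longrightarrow> T \<inter> g -` B \<in> sets lebesgue"
    and T: "bounded T" and e: "0 < e"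
  obtains K where "compact K" "K \<subseteq> T" "emeasure lebesgue (T - K) \<le> ennreal e" "continuous_on K g"
proof -
  have "\<exists>K. compact K \<and> K \<subseteq> T \<and> emeasure lebesgue (T - K) \<le> ennreal (e * (1 / 2) ^ Suc n) \<and>
    (\<forall>x\<in>K. \<exists>d>0. \<forall>y\<in>K. dist y x < d \<longrightarrow> dist (g y) (g x) < 1 / Suc n)" for n
    by (rule lusin_oscillation[OF meas T, of "1 / Suc n" "e * (1 / 2) ^ Suc n"]) (use e in auto)
  then obtain K where K: "\<And>n. compact (K n)" "\<And>n. K n \<subseteq> T"
    "\<And>n. emeasure lebesgue (T - K n) \<le> ennreal (e * (1 / 2) ^ Suc n)"
    "\<And>n x. x \<in> K n \<Longrightarrow> \<exists>d>0. \<forall>y\<in>K n. dist y x < d \<longrightarrow> dist (g y) (g x) < 1 / Suc n"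
    by metis
  show ?thesis
  proof (rule that)
    show "compact (\<Inter>n. K n)"
      using K(1) by (metis (no_types, lifting) INT_lower UNIV_I closed_INT compact_Int_closed compact_imp_closed inf.absorb_iff2 Int_commute)
    show "(\<Inter>n. K n) \<subseteq> T"
      using K(2) by blast
    have "T - (\<Inter>n. K n) = (\<Union>n. T - K n)"
      by blast
    also have "emeasure lebesgue \<dots> \<le> (\<Sum>n. emeasure lebesgue (T - K n))"
      using meas[of UNIV] K(1) by (intro emeasure_subadditive_countably) (auto intro: sets.Diff fmeasurableD lmeasurable_compact)
    also have "\<dots> \<le> (\<Sum>n. ennreal (e * (1 / 2) ^ Suc n))"
      using K(3) by (intro suminf_le) auto
    also have "\<dots> = ennreal e"
      using e sums_mult[OF power_half_series, of e] by (intro suminf_ennreal_eq) auto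
    finally show "emeasure lebesgue (T - (\<Inter>n. K n)) \<le> ennreal e" .
    show "continuous_on (\<Inter>n. K n) g"
      unfolding continuous_on_iff
    proof (intro ballI allI impI)
      fix x and \<delta> :: real assume x: "x \<in> (\<Inter>n. K n)" and "0 < \<delta>"
      then obtain n where n: "1 / Suc n < \<delta>"
        using nat_approx_posE by blast
      obtain d where "d > 0" "\<forall>y\<in>K n. dist y x < d \<longrightarrow> dist (g y) (g x) < 1 / Suc n"
        using K(4)[of x n] x by blast
      with n show "\<exists>d>0. \<forall>y\<in>\<Inter>n. K n. dist y x < d \<longrightarrow> dist (g y) (g x) < \<delta>"
        by (metis INT_D UNIV_I order.strict_trans)
    qed
  qed
qed

text \<open>Continuous images of compact subsets of an interval exhaust \<open>Y\<close> outside of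
  \<open>S\<close>, and finite sets exhaust it inside \<open>S\<close>. Each of the two parts loses
  at most e / 2.\<close>

lemma tight_lebesgue_space:
  fixes M :: "'a::metric_space measure"
  assumes sets_M: "sets M = sets borel" and fin: "finite_measure M" and leb: "lebesgue_space M"
    and Y: "Y \<in> sets M" and e: "0 < e"
  obtains K where "compact K" "K \<subseteq> Y" "measure M Y \<le> measure M K + e"
proof -
  interpret finite_measure M by fact
  have space_M: "space M = UNIV"
    using sets_eq_imp_space_eq[OF sets_M] by simp
  obtain S s where S: "countable S" "\<forall>x\<in>S. {x} \<in> sets M"
    and iso: "iso_mod_0 (restrict_space M (space M - S)) (restrict_space lborel {0..s::real})"
    using leb unfolding lebesgue_space_def by blast
  define M1 where "M1 = restrict_space M (- S)"
  define N1 where "N1 = restrict_space lborel {0..s}"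
  have S_sets: "P \<in> sets M" if "P \<subseteq> S" for P
  proof -
    have "(\<Union>x\<in>P. {x}) \<in> sets M"
      using S that by (intro sets.countable_UN') (auto intro: countable_subset)
    then show ?thesis by simp
  qed
  then have S_compl: "- S \<in> sets M"
    using sets.compl_sets[of S M] by (simp add: space_M Compl_eq_Diff_UNIV)
  have sets_M1: "C \<in> sets M1 \<longleftrightarrow> C \<in> sets M \<and> C \<subseteq> - S" for C
    unfolding M1_def using S_compl by (auto simp: sets_restrict_space_iff)
  have em_M1: "emeasure M1 C = emeasure M C" if "C \<subseteq> - S" for C
    unfolding M1_def using S_compl that by (simp add: emeasure_restrict_space)
  have sets_N1: "C \<in> sets N1 \<longleftrightarrow> C \<in> sets borel \<and> C \<subseteq> {0..s}" for C
    unfolding N1_def by (auto simp: sets_restrict_space_iff)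
  have em_N1: "emeasure N1 C = emeasure lborel C" if "C \<subseteq> {0..s}" for C
    unfolding N1_def using that by (simp add: emeasure_restrict_space)
  have null_N1: "C \<in> null_sets lborel" if "C \<in> null_sets N1" for C
    using that by (auto simp: null_sets_def sets_N1 em_N1)
  \<comment> \<open>The isomorphism concerns the completion of the restricted measure, Lusin's
    theorem concerns \<open>lebesgue\<close>; this passes from the first to the second.\<close>
  have compl_N1: "C \<in> sets lebesgue \<and> emeasure (completion N1) C = emeasure lebesgue C"
    if C: "C \<in> sets (completion N1)" for C
  proof -
    obtain P N N' where P: "C = P \<union> N" "N \<subseteq> N'" "N' \<in> null_sets N1" "P \<in> sets N1"
      using C by (rule sets_completionE)
    have N: "N \<in> null_sets (completion N1)" "N \<in> null_sets lebesgue"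
      using P(2,3) null_N1 by (auto intro: null_sets_completion_subset null_sets_completionI simp: null_sets_completion_iff2)
    have "emeasure (completion N1) C = emeasure (completion N1) P"
      unfolding P(1) using N(1) P(4) by (intro emeasure_Un_null_set) auto
    also have "\<dots> = emeasure lborel P"
      using P(4) by (simp add: em_N1 sets_N1)
    also have "\<dots> = emeasure lebesgue P"
      using P(4) by (simp add: sets_N1)
    also have "\<dots> = emeasure lebesgue C"
      unfolding P(1) using N(2) P(4) by (intro emeasure_Un_null_set[symmetric]) (auto simp: sets_N1)
    finally show ?thesis
      using P(1,4) N(2) by (auto simp: sets_N1)
  qed
  obtain A B f g where A: "A \<in> null_sets (completion M1)" and B: "B \<in> null_sets (completion N1)"
    and f: "f \<in> measurable (restrict_space (completion M1) (space M1 - A)) (restrict_space (completion N1) (space N1 - B))"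
    and g: "g \<in> measurable (restrict_space (completion N1) (space N1 - B)) (restrict_space (completion M1) (space M1 - A))"
    and gf: "\<And>x. x \<in> space M1 - A \<Longrightarrow> g (f x) = x"
    and fg: "\<And>y. y \<in> space N1 - B \<Longrightarrow> f (g y) = y"
    and distr: "distr (restrict_space (completion M1) (space M1 - A)) (restrict_space (completion N1) (space N1 - B)) f
      = restrict_space (completion N1) (space N1 - B)"
    using iso unfolding iso_mod_0_def Let_def M1_def[symmetric] N1_def[symmetric]
      space_M Compl_eq_Diff_UNIV[symmetric]
    by (auto simp: space_restrict_space)
  define X where "X = space M1 - A"
  define T where "T = space N1 - B"
  have X: "X \<in> sets (completion M1)" and T: "T \<in> sets (completion N1)"
    using A B by (auto simp: X_def T_def sets.compl_sets[of _ "completion _", simplified])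
  then have sets_X: "C \<in> sets (restrict_space (completion M1) X) \<longleftrightarrow> C \<in> sets (completion M1) \<and> C \<subseteq> X"
    and sets_T: "C' \<in> sets (restrict_space (completion N1) T) \<longleftrightarrow> C' \<in> sets (completion N1) \<and> C' \<subseteq> T" for C C'
    by (subst sets_restrict_space_iff; auto dest: sets.sets_into_space simp: Int_absorb2)+
  have X_S: "X \<subseteq> - S" and T_s: "T \<subseteq> {0..s}"
    by (auto simp: X_def T_def M1_def N1_def space_restrict_space space_M)
  have f_T: "f x \<in> T" if "x \<in> X" for x
    using measurable_space[OF f] that by (auto simp: space_restrict_space X_def T_def)
  have g_X: "g y \<in> X" if "y \<in> T" for y
    using measurable_space[OF g] that by (auto simp: space_restrict_space X_def T_def)
  \<comment> \<open>Pulling the preimage of \<open>D\<close> under \<open>g\<close> back by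
    \<open>f\<close> gives \<open>D \<inter> X\<close>, which is \<open>D - S\<close> without the
    null set \<open>A\<close>; since \<open>f\<close> preserves the measure, the two sides
    agree.\<close>
  have D: "T \<inter> g -` D \<in> sets (completion N1) \<and> emeasure lebesgue (T \<inter> g -` D) = emeasure M (D - S)"
    if "D \<in> sets borel" for D
  proof -
    have DS: "D - S \<in> sets M1"
      using that S_sets sets_M by (auto simp: sets_M1)
    have DX_eq: "D \<inter> X = D - S - A"
      by (auto simp: X_def M1_def space_restrict_space space_M)
    then have DX: "D \<inter> X \<in> sets (completion M1)"
      using DS A by auto
    let ?E = "T \<inter> g -` D"
    have "g -` (D \<inter> X) \<inter> space (restrict_space (completion N1) T) \<in> sets (restrict_space (completion N1) T)"
      using DX sets_X by (intro measurable_sets[OF g[folded X_def T_def]]) auto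
    also have "g -` (D \<inter> X) \<inter> space (restrict_space (completion N1) T) = ?E"
      using g_X T_s by (auto simp: space_restrict_space T_def)
    finally have E': "?E \<in> sets (restrict_space (completion N1) T)" .
    then have E: "?E \<in> sets (completion N1)"
      using sets_T by auto
    have "emeasure lebesgue ?E = emeasure (restrict_space (completion N1) T) ?E"
      using E T compl_N1[OF E] by (subst emeasure_restrict_space) auto
    also have "\<dots> = emeasure (restrict_space (completion M1) X) (f -` ?E \<inter> space (restrict_space (completion M1) X))"
      using emeasure_distr[OF f[folded X_def T_def] E'] by (simp only: distr[folded X_def T_def])
    also have "f -` ?E \<inter> space (restrict_space (completion M1) X) = D \<inter> X"
      using gf f_T by (auto simp: space_restrict_space X_def)
    also have "emeasure (restrict_space (completion M1) X) (D \<inter> X) = emeasure (completion M1) (D \<inter> X)"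
      using X by (subst emeasure_restrict_space) auto
    also have "\<dots> = emeasure (completion M1) (D - S)"
      unfolding DX_eq using A DS by (intro emeasure_Diff_null_set) auto
    also have "\<dots> = emeasure M (D - S)"
      using DS em_M1[of "D - S"] by (simp add: Diff_subset_conv)
    finally show ?thesis
      using E by simp
  qed
  define T' where "T' = T \<inter> g -` Y"
  have YS: "Y - S \<in> sets M" "Y \<inter> S \<in> sets M"
    using Y S_sets by auto
  have T'_meas: "T' \<inter> g -` C \<in> sets lebesgue" if "C \<in> sets borel" for C
    using D[of "Y \<inter> C"] that Y sets_M compl_N1 by (auto simp: T'_def Int_assoc vimage_Int)
  obtain K where K: "compact K" "K \<subseteq> T'" "emeasure lebesgue (T' - K) \<le> ennreal (e / 2)" "continuous_on K g"
    by (rule lusin[of T' g "e / 2", OF T'_meas])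
      (use T_s e in \<open>auto simp: T'_def intro: bounded_subset[of "{0..s}"]\<close>)
  have gK: "compact (g ` K)" "g ` K \<subseteq> Y - S"
    using K g_X X_S by (auto simp: T'_def intro: compact_continuous_image)
  then have gK_meas: "g ` K \<in> sets borel"
    by (simp add: borel_closed compact_imp_closed)
  \<comment> \<open>\<open>f\<close> inverts \<open>g\<close> on \<open>T\<close>, so
    \<open>g\<close> is injective there and the Lebesgue measure of \<open>K\<close> is the measure
    of its image.\<close>
  have "T \<inter> g -` (g ` K) = K"
  proof (intro equalityI subsetI)
    fix y assume "y \<in> T \<inter> g -` (g ` K)"
    then obtain k where k: "y \<in> T" "k \<in> K" "g y = g k"
      by blast
    then have "k \<in> T"
      using K(2) by (auto simp: T'_def)
    then have "y = k"
      using fg[of y] fg[of k] k(1,3) by (simp add: T_def)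
    with k(2) show "y \<in> K"
      by simp
  qed (use K(2) in \<open>auto simp: T'_def\<close>)
  then have "emeasure lebesgue K = emeasure M (g ` K - S)"
    using D[OF gK_meas] by (simp only:)
  also have "g ` K - S = g ` K"
    using gK(2) by auto
  finally have K_eq: "emeasure lebesgue K = emeasure M (g ` K)" .
  have "emeasure M (Y - S) = emeasure lebesgue T'"
    using D Y sets_M by (simp add: T'_def)
  also have "\<dots> \<le> emeasure lebesgue (K \<union> (T' - K))"
    using T'_meas[of UNIV] K(1) by (intro emeasure_mono) (auto intro: fmeasurableD lmeasurable_compact)
  also have "\<dots> \<le> emeasure lebesgue K + emeasure lebesgue (T' - K)"
    using T'_meas[of UNIV] K(1) by (intro emeasure_subadditive) (auto intro: fmeasurableD lmeasurable_compact)
  also have "\<dots> \<le> emeasure M (g ` K) + ennreal (e / 2)"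
    using K(3) K_eq by (simp add: add_left_mono)
  finally have "ennreal (measure M (Y - S)) \<le> ennreal (measure M (g ` K) + e / 2)"
    using e by (simp add: emeasure_eq_measure)
  then have 1: "measure M (Y - S) \<le> measure M (g ` K) + e / 2"
    using e by (subst (asm) ennreal_le_iff) auto
  obtain P where P: "finite P" "P \<subseteq> Y \<inter> S"
    "measure M (\<Union>x\<in>Y \<inter> S. {x}) < measure M (\<Union>x\<in>P. {x}) + e / 2"
    using measure_UN_finite_approx[of "Y \<inter> S" "\<lambda>x. {x}" "e / 2"] S e by auto
  show ?thesis
  proof (rule that)
    show "compact (g ` K \<union> P)"
      using gK(1) P(1) by (simp add: compact_Un finite_imp_compact)
    show "g ` K \<union> P \<subseteq> Y"
      using gK(2) P(2) by auto
    have "measure M Y = measure M (Y - S) + measure M (Y \<inter> S)"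
      using Y S_sets[of S] by (metis Diff_disjoint Int_Diff_disjoint Un_Diff_Int YS finite_measure_Union inf_commute)
    also have "\<dots> \<le> measure M (g ` K) + measure M P + e"
      using 1 P(3) by simp
    also have "measure M (g ` K) + measure M P = measure M (g ` K \<union> P)"
      using gK(2) gK_meas P(2) S_sets sets_M by (intro finite_measure_Union[symmetric]) auto
    finally show "measure M Y \<le> measure M (g ` K \<union> P) + e" .
  qed
qed

section \<open>Maximal ergodic inequality\<close>

text \<open>Garsia's argument: the running maximum \<open>m n\<close> of the partial sums satisfies
  \<open>m (Suc n) = u + m n \<circ> T\<close> where it is positive.\<close>

lemma (in finite_measure) maximal_ergodic:
  fixes h :: "'a \<Rightarrow> real"
  assumes T: "T \<in> measurable M M" "distr M M T = M"
    and h: "integrable M h" "\<And>x. x \<in> space M \<Longrightarrow> 0 \<le> h x" and \<alpha>: "0 < \<alpha>"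
  shows "measure M {x \<in> space M. \<exists>n. \<alpha> * real n < (\<Sum>l<n. h ((T ^^ l) x))} \<le> (\<integral>x. h x \<partial>M) / \<alpha>"
proof -
  define u where "u x = h x - \<alpha>" for x
  \<comment> \<open>Unrolled, \<open>m n x\<close> is the maximum over j \<le> n of the sums of
    \<open>u\<close> over the first j points of the orbit; the 0 is the empty sum.\<close>
  define m where "m = rec_nat (\<lambda>_. 0) (\<lambda>_ f x. max 0 (u x + f (T x)))"
  have m_0: "m 0 x = 0" and m_Suc: "m (Suc n) x = max 0 (u x + m n (T x))" for n x
    by (simp_all add: m_def)
  have u_int: "integrable M u"
    unfolding u_def using h(1) by auto
  have m_int: "integrable M (m n)" for n
  proof (induction n)
    case 0
    then show ?case by (simp add: m_0 fun_eq_iff[symmetric] cong: integrable_cong)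
  next
    case (Suc n)
    have "integrable M (\<lambda>x. m n (T x))"
      using Suc T by (intro integrable_distr[OF T(1)]) simp
    then have "integrable M (\<lambda>x. max 0 (u x + m n (T x)))"
      using u_int by (intro integrable_max) auto
    then show ?case
      by (simp add: m_Suc cong: integrable_cong)
  qed
  have m_nonneg: "0 \<le> m n x" for n x
    by (cases n) (simp_all add: m_0 m_Suc)
  have m_mono: "m n x \<le> m (Suc n) x" for n x
  proof (induction n arbitrary: x)
    case (Suc n)
    show ?case
      unfolding m_Suc[of n x] m_Suc[of "Suc n" x] using Suc[of "T x"] by simp
  qed (simp add: m_0 m_nonneg)
  have sum_le: "(\<Sum>l<n. u ((T ^^ l) x)) \<le> m n x" for n x
  proof (induction n arbitrary: x)
    case (Suc n)
    have "(\<Sum>l<Suc n. u ((T ^^ l) x)) = u x + (\<Sum>l<n. u ((T ^^ l) (T x)))"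
      by (simp add: sum.lessThan_Suc_shift funpow_swap1 del: sum.lessThan_Suc)
    then show ?case
      using Suc[of "T x"] by (simp add: m_Suc)
  qed (simp add: m_0)
  define A where "A n = {x \<in> space M. 0 < m n x}" for n
  have A: "A n \<in> sets M" for n
    unfolding A_def using borel_measurable_integrable[OF m_int] by measurable
  have ind: "integrable M (\<lambda>x. indicator (A n) x * f x)" if "integrable M f" for n and f :: "'a \<Rightarrow> real"
    using integrable_mult_indicator[OF A that] by simp
  have A_le: "measure M (A n) \<le> (\<integral>x. h x \<partial>M) / \<alpha>" for n
  proof (cases n)
    case 0
    then have "A n = {}"
      by (simp add: A_def m_0)
    then show ?thesis
      using h \<alpha> by simp
  next
    case (Suc k)
    have mT: "integrable M (\<lambda>x. m n (T x))"
      using m_int T by (intro integrable_distr[OF T(1)]) simp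
    have "(\<integral>x. m n x \<partial>M) - (\<integral>x. m n (T x) \<partial>M) = (\<integral>x. m n x - m n (T x) \<partial>M)"
      using m_int mT by simp
    \<comment> \<open>On \<open>A n\<close> the recursion gives
      \<open>m n x = u x + m k (T x)\<close>, at most \<open>u x + m n (T x)\<close>; elsewhere the
      integrand on the left is at most 0. The integrals of \<open>m n\<close> and of its composition
      with \<open>T\<close> cancel by invariance.\<close>
    also have "\<dots> \<le> (\<integral>x. indicator (A n) x * u x \<partial>M)"
    proof (rule integral_mono)
      show "integrable M (\<lambda>x. m n x - m n (T x))"
        using m_int mT by simp
      show "integrable M (\<lambda>x. indicator (A n) x * u x)"
        by (rule ind[OF u_int])
      fix x assume "x \<in> space M"
      show "m n x - m n (T x) \<le> indicator (A n) x * u x"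
      proof (cases "x \<in> A n")
        case True
        then have "m n x = u x + m k (T x)"
          by (auto simp: A_def Suc m_Suc)
        with True m_mono[of k "T x"] show ?thesis
          by (simp add: Suc)
      next
        case False
        then have "m n x = 0"
          using m_nonneg[of n x] \<open>x \<in> space M\<close> by (simp add: A_def)
        with False m_nonneg show ?thesis
          by simp
      qed
    qed
    also have "\<dots> = (\<integral>x. indicator (A n) x * h x - indicator (A n) x * \<alpha> \<partial>M)"
      by (simp add: u_def right_diff_distrib)
    also have "\<dots> = (\<integral>x. indicator (A n) x * h x \<partial>M) - measure M (A n) * \<alpha>"
      using A ind[OF h(1)] by (subst Bochner_Integration.integral_diff) (auto simp: emeasure_eq_measure)
    also have "(\<integral>x. m n (T x) \<partial>M) = (\<integral>x. m n x \<partial>M)"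
      using T m_int by (subst integral_distr[symmetric, OF T(1)]) auto
    finally have "measure M (A n) * \<alpha> \<le> (\<integral>x. indicator (A n) x * h x \<partial>M)"
      by simp
    also have "\<dots> \<le> (\<integral>x. h x \<partial>M)"
      using h by (intro integral_mono ind) (auto simp: indicator_def)
    finally show ?thesis
      using \<alpha> by (simp add: field_simps)
  qed
  have "(\<lambda>n. measure M (A n)) \<longlonglongrightarrow> measure M (\<Union>n. A n)"
    using A m_mono by (intro finite_Lim_measure_incseq incseq_SucI) (auto simp: A_def intro: less_le_trans)
  then have "measure M (\<Union>n. A n) \<le> (\<integral>x. h x \<partial>M) / \<alpha>"
    by (rule LIMSEQ_le_const2) (use A_le in auto)
  moreover have "{x \<in> space M. \<exists>n. \<alpha> * real n < (\<Sum>l<n. h ((T ^^ l) x))} \<subseteq> (\<Union>n. A n)"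
  proof clarify
    fix x n assume x: "x \<in> space M" "\<alpha> * real n < (\<Sum>l<n. h ((T ^^ l) x))"
    then have "0 < (\<Sum>l<n. u ((T ^^ l) x))"
      by (simp add: u_def sum_subtractf mult.commute)
    with sum_le[of x n] x(1) show "x \<in> (\<Union>n. A n)"
      by (auto simp: A_def intro: less_le_trans)
  qed
  then have "measure M {x \<in> space M. \<exists>n. \<alpha> * real n < (\<Sum>l<n. h ((T ^^ l) x))} \<le> measure M (\<Union>n. A n)"
    using A by (intro finite_measure_mono) auto
  ultimately show ?thesis
    by linarith
qed

section \<open>Distance of splittings at regular points\<close>

lemma matrix_norm_pos: "0 \<le> matrix_norm B"
  by (simp add: onorm_pos_le)

lemma norm_matrix_vector_le: "norm (B *v v) \<le> matrix_norm B * norm v"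
  by (simp add: onorm)

lemma matrix_norm_mult: "matrix_norm (B ** D) \<le> matrix_norm B * matrix_norm D"
proof -
  have "(*v) (B ** D) = (*v) B \<circ> (*v) D"
    by (simp add: fun_eq_iff matrix_vector_mul_assoc)
  then show ?thesis
    by (simp add: onorm_compose)
qed

lemma matrix_norm_add: "matrix_norm (B + D) \<le> matrix_norm B + matrix_norm D"
proof -
  have "(*v) (B + D) = (\<lambda>v. B *v v + D *v v)"
    by (simp add: fun_eq_iff matrix_vector_mult_add_rdistrib)
  then show ?thesis
    by (simp add: onorm_triangle)
qed

lemma subspace_dist_le:
  assumes "subspace V" "V \<noteq> {0}" "subspace W" "W \<noteq> {0}"
    and "\<And>v. \<lbrakk>v \<in> V; norm v = 1\<rbrakk> \<Longrightarrow> infdist v W \<le> r" "\<And>v. \<lbrakk>v \<in> W; norm v = 1\<rbrakk> \<Longrightarrow> infdist v V \<le> r"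
  shows "subspace_dist V W \<le> r"
proof -
  have "{v \<in> U. norm v = 1} \<noteq> {}" if U: "subspace U" "U \<noteq> {0}" for U :: "(real ^ 'n) set"
  proof -
    obtain u where "u \<in> U" "u \<noteq> 0"
      using U subspace_0[OF U(1)] by blast
    then have "(1 / norm u) *\<^sub>R u \<in> {v \<in> U. norm v = 1}"
      using U(1) by (simp add: subspace_scale)
    then show ?thesis by blast
  qed
  with assms show ?thesis
    unfolding subspace_dist_def by (intro max.boundedI cSUP_least) auto
qed

text \<open>\<open>G\<close> is a set of uniformly regular points. The function \<open>h\<close> pays at least \<open>1\<close> and at least
  the logarithmic expansion of one step for every visit outside of \<open>G\<close>.\<close>

locale regular_block =
  fixes \<phi> :: "real \<Rightarrow> 'a::metric_space \<Rightarrow> 'a" and A :: "'a \<Rightarrow> real \<Rightarrow> real ^ 'n ^ 'n"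
    and k :: nat and \<kappa> :: "nat \<Rightarrow> real" and E :: "nat \<Rightarrow> 'a \<Rightarrow> (real ^ 'n) set"
    and G :: "'a set" and h :: "'a \<Rightarrow> real" and C \<epsilon> H L \<nu> :: real
  assumes flow_0: "\<phi> 0 x = x" and flow_add: "\<phi> t (\<phi> s x) = \<phi> (t + s) x"
    and cocycle_0: "A x 0 = mat 1" and cocycle_add: "A x (t + s) = A (\<phi> t x) s ** A x t"
    and splitting: "x \<in> G \<Longrightarrow> direct_sum_splitting k (\<lambda>i. E i x)"
    and nonzero: "\<lbrakk>x \<in> G; i < k\<rbrakk> \<Longrightarrow> E i x \<noteq> {0}"
    and equivariant: "\<lbrakk>x \<in> G; i < k\<rbrakk> \<Longrightarrow> (*v) (A x t) ` E i x = E i (\<phi> t x)"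
    and upper: "\<lbrakk>x \<in> G; i < k; v \<in> E i x; \<sigma> \<in> {1, -1}\<rbrakk>
      \<Longrightarrow> norm (A x (\<sigma> * real n) *v v) \<le> C * exp ((\<sigma> * \<kappa> i + \<epsilon>) * real n) * norm v"
    and projection: "\<lbrakk>x \<in> G; w \<in> (\<Pi>\<^sub>E i\<in>{..<k}. E i x); i < k\<rbrakk> \<Longrightarrow> norm (w i) \<le> C * norm (\<Sum>i<k. w i)"
    and h_nonneg: "0 \<le> h x" and h_ge_1: "x \<notin> G \<Longrightarrow> 1 \<le> h x"
    and h_step: "\<lbrakk>x \<notin> G; \<sigma> \<in> {1, -1}\<rbrakk> \<Longrightarrow> matrix_norm (A x \<sigma>) \<le> exp (h x)"
    and holder: "\<sigma> \<in> {1, -1} \<Longrightarrow> matrix_norm (A x \<sigma> - A y \<sigma>) \<le> H * dist x y powr \<nu>"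
    and lipschitz: "\<sigma> \<in> {1, -1} \<Longrightarrow> dist (\<phi> \<sigma> x) (\<phi> \<sigma> y) \<le> L * dist x y"
    and C_pos: "0 < C" and H_pos: "0 < H" and L_ge_1: "1 \<le> L" and \<nu>_pos: "0 < \<nu>" and \<epsilon>_pos: "0 < \<epsilon>"
begin

definition "c = (\<Sum>i<k. \<bar>\<kappa> i\<bar>)"

text \<open>Projecting to a component and the growth on it cost one factor \<open>C\<close> each,
  and there are \<open>k\<close> components. The summand 1 covers time 0 at points outside of
  \<open>G\<close>.\<close>

definition "C1 = real k * C\<^sup>2 + 1"

text \<open>The rate in \<open>cocycle_difference\<close>: \<open>c + \<epsilon>\<close> for the
  growth before and again after the step at which the two orbits are exchanged, 1 / 2 for the visits
  outside of \<open>G\<close>, 1 for the number of such steps, \<open>\<nu> * ln L\<close> for the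
  spreading of the orbits. Neither \<open>C\<close> nor \<open>H\<close> occurs.\<close>

definition "a = 2 * (c + \<epsilon>) + 3 / 2 + \<nu> * ln L"

text \<open>The budget of one half per step serves twice: it bounds the extra growth along the
  orbit, and since a visit outside of \<open>G\<close> costs at least 1, it forces visits to
  \<open>G\<close> in every window \<open>{N..2 * N}\<close>.\<close>

definition "seldom_bad x \<longleftrightarrow> (\<forall>\<sigma>\<in>{1, -1}. \<forall>n. (\<Sum>l<n. h (\<phi> (\<sigma> * real l) x)) \<le> real n / 2)"

lemma abs_\<kappa>_le: "i < k \<Longrightarrow> \<bar>\<kappa> i\<bar> \<le> c"
  unfolding c_def by (rule member_le_sum) auto

lemma c_nonneg: "0 \<le> c"
  by (simp add: c_def sum_nonneg)

lemma C1_ge_1: "1 \<le> C1"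
  by (simp add: C1_def)

section \<open>Growth of the cocycle along orbits\<close>

lemma decomposition:
  assumes "x \<in> G"
  obtains w where "w \<in> (\<Pi>\<^sub>E i\<in>{..<k}. E i x)" "(\<Sum>i<k. w i) = v"
  using splitting[OF assms] unfolding direct_sum_splitting_def by metis

lemma growth_good:
  assumes x: "x \<in> G" and \<sigma>: "\<sigma> \<in> {1, -1}"
  shows "matrix_norm (A x (\<sigma> * real n)) \<le> C1 * exp ((c + \<epsilon>) * real n)"
proof (rule onorm_bound)
  fix v
  obtain w where w: "w \<in> (\<Pi>\<^sub>E i\<in>{..<k}. E i x)" "(\<Sum>i<k. w i) = v"
    using decomposition[OF x] .
  have "norm (A x (\<sigma> * real n) *v v) = norm (\<Sum>i<k. A x (\<sigma> * real n) *v w i)"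
    by (simp add: w(2)[symmetric] linear_sum[OF matrix_vector_mul_linear])
  also have "\<dots> \<le> (\<Sum>i<k. C * exp ((c + \<epsilon>) * real n) * (C * norm v))"
  proof (rule sum_norm_le)
    fix i assume "i \<in> {..<k}"
    then have i: "i < k" by simp
    then have "norm (A x (\<sigma> * real n) *v w i) \<le> C * exp ((\<sigma> * \<kappa> i + \<epsilon>) * real n) * norm (w i)"
      using w(1) by (intro upper x \<sigma>) auto
    also have "\<dots> \<le> C * exp ((c + \<epsilon>) * real n) * (C * norm v)"
    proof (intro mult_mono)
      have "\<sigma> * \<kappa> i \<le> c"
        using abs_\<kappa>_le[OF i] \<sigma> by auto
      then show "exp ((\<sigma> * \<kappa> i + \<epsilon>) * real n) \<le> exp ((c + \<epsilon>) * real n)"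
        by (simp add: mult_right_mono)
      show "norm (w i) \<le> C * norm v"
        using projection[OF x w(1) i] w(2) by simp
    qed (use C_pos in auto)
    finally show "norm (A x (\<sigma> * real n) *v w i) \<le> C * exp ((c + \<epsilon>) * real n) * (C * norm v)" .
  qed
  also have "\<dots> = (real k * C\<^sup>2) * exp ((c + \<epsilon>) * real n) * norm v"
    by (simp add: power2_eq_square)
  also have "\<dots> \<le> C1 * exp ((c + \<epsilon>) * real n) * norm v"
    by (intro mult_right_mono) (auto simp: C1_def)
  finally show "norm (A x (\<sigma> * real n) *v v) \<le> C1 * exp ((c + \<epsilon>) * real n) * norm v" .
qed (use C1_ge_1 in auto)

text \<open>Steps are paid for one at a time only until the orbit first enters \<open>G\<close>;
  from there \<open>growth_good\<close> covers the whole remaining time. So \<open>C1\<close> enters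
  once, and not once per visit.\<close>

lemma growth:
  assumes \<sigma>: "\<sigma> \<in> {1, -1}"
  shows "matrix_norm (A z (\<sigma> * real m)) \<le> C1 * exp ((c + \<epsilon>) * real m + (\<Sum>q<m. h (\<phi> (\<sigma> * real q) z)))"
proof (induction m arbitrary: z)
  case 0
  then show ?case
    by (simp add: cocycle_0 order_trans[OF onorm_id_le C1_ge_1])
next
  case (Suc m)
  show ?case
  proof (cases "z \<in> G")
    case True
    have "C1 * exp ((c + \<epsilon>) * real (Suc m)) \<le>
        C1 * exp ((c + \<epsilon>) * real (Suc m) + (\<Sum>q<Suc m. h (\<phi> (\<sigma> * real q) z)))"
      using C1_ge_1 by (intro mult_left_mono) (auto intro!: sum_nonneg h_nonneg simp del: sum.lessThan_Suc)
    with growth_good[OF True \<sigma>, of "Suc m"] show ?thesis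
      by linarith
  next
    case False
    have "A z (\<sigma> * real (Suc m)) = A (\<phi> \<sigma> z) (\<sigma> * real m) ** A z \<sigma>"
      using cocycle_add[of z \<sigma> "\<sigma> * real m"] by (simp add: algebra_simps)
    then have "matrix_norm (A z (\<sigma> * real (Suc m))) \<le> matrix_norm (A (\<phi> \<sigma> z) (\<sigma> * real m)) * matrix_norm (A z \<sigma>)"
      by (simp only: matrix_norm_mult)
    also have "\<dots> \<le> C1 * exp ((c + \<epsilon>) * real m + (\<Sum>q<m. h (\<phi> (\<sigma> * real q) (\<phi> \<sigma> z)))) * exp (h z)"
      using C1_ge_1 by (intro mult_mono Suc.IH h_step[OF False \<sigma>] matrix_norm_pos) auto
    also have "\<dots> = C1 * exp ((c + \<epsilon>) * real m + (h z + (\<Sum>q<m. h (\<phi> (\<sigma> * real q) (\<phi> \<sigma> z)))))"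
      by (simp add: exp_add)
    also have "h z + (\<Sum>q<m. h (\<phi> (\<sigma> * real q) (\<phi> \<sigma> z))) = (\<Sum>q<Suc m. h (\<phi> (\<sigma> * real q) z))"
      by (subst sum.lessThan_Suc_shift) (simp add: flow_add flow_0 algebra_simps)
    also have "C1 * exp ((c + \<epsilon>) * real m + (\<Sum>q<Suc m. h (\<phi> (\<sigma> * real q) z)))
      \<le> C1 * exp ((c + \<epsilon>) * real (Suc m) + (\<Sum>q<Suc m. h (\<phi> (\<sigma> * real q) z)))"
      using C1_ge_1 c_nonneg \<epsilon>_pos by (intro mult_left_mono) (auto simp: algebra_simps)
    finally show ?thesis .
  qed
qed

lemma orbit_dist:
  assumes "\<sigma> \<in> {1, -1}"
  shows "dist (\<phi> (\<sigma> * real m) x) (\<phi> (\<sigma> * real m) y) \<le> L ^ m * dist x y"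
proof (induction m)
  case (Suc m)
  have "\<phi> (\<sigma> * real (Suc m)) z = \<phi> \<sigma> (\<phi> (\<sigma> * real m) z)" for z
    by (simp add: flow_add algebra_simps)
  then have "dist (\<phi> (\<sigma> * real (Suc m)) x) (\<phi> (\<sigma> * real (Suc m)) y) \<le> L * dist (\<phi> (\<sigma> * real m) x) (\<phi> (\<sigma> * real m) y)"
    using lipschitz[OF assms] by simp
  also have "\<dots> \<le> L * (L ^ m * dist x y)"
    using Suc L_ge_1 by (intro mult_left_mono) auto
  finally show ?case
    by (simp add: mult.assoc)
qed (simp add: flow_0)

text \<open>Telescoping over the time \<open>m\<close> up to which the product follows
  \<open>y\<close> before it continues along \<open>x\<close>. The factor along \<open>x\<close>
  starts at a shifted point that may be outside of \<open>G\<close>, whence \<open>growth\<close>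
  and the budget of \<open>x\<close>; the factor along \<open>y\<close> starts at \<open>y\<close>
  itself, whence \<open>growth_good\<close>.\<close>

lemma cocycle_difference:
  assumes \<sigma>: "\<sigma> \<in> {1, -1}" and x: "seldom_bad x" and y: "y \<in> G"
  shows "matrix_norm (A x (\<sigma> * real n) - A y (\<sigma> * real n)) \<le> C1\<^sup>2 * H * exp (a * real n) * dist x y powr \<nu>"
proof -
  define R where "R = C1 * exp ((c + \<epsilon>) * real n + real n / 2) *
    (H * (exp (\<nu> * ln L * real n) * dist x y powr \<nu>)) * (C1 * exp ((c + \<epsilon>) * real n))"
  have "matrix_norm (A x (\<sigma> * real n) - A (\<phi> (\<sigma> * real m) x) (\<sigma> * real (n - m)) ** A y (\<sigma> * real m)) \<le> real m * R"
    if "m \<le> n" for m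
    using that
  proof (induction m)
    case 0
    then show ?case
      by (simp add: flow_0 cocycle_0 onorm_zero)
  next
    case (Suc m)
    define l where "l = n - Suc m"
    have n: "n = Suc m + l"
      using Suc.prems by (simp add: l_def)
    let ?x = "\<phi> (\<sigma> * real m) x" and ?y = "\<phi> (\<sigma> * real m) y"
    let ?P = "A (\<phi> (\<sigma> * real (Suc m)) x) (\<sigma> * real l)"
    have 1: "A ?x (\<sigma> * real (n - m)) = ?P ** A ?x \<sigma>"
      using cocycle_add[of ?x \<sigma> "\<sigma> * real l"] by (simp add: n flow_add algebra_simps)
    have 2: "A y (\<sigma> * real (Suc m)) = A ?y \<sigma> ** A y (\<sigma> * real m)"
      using cocycle_add[of y "\<sigma> * real m" \<sigma>] by (simp add: algebra_simps)
    have "A x (\<sigma> * real n) - ?P ** A y (\<sigma> * real (Suc m))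
      = (A x (\<sigma> * real n) - A ?x (\<sigma> * real (n - m)) ** A y (\<sigma> * real m)) + ?P ** (A ?x \<sigma> - A ?y \<sigma>) ** A y (\<sigma> * real m)"
      unfolding 1 2 by (simp add: matrix_eq matrix_vector_mult_diff_rdistrib matrix_vector_mult_add_rdistrib
          matrix_vector_mult_diff_distrib flip: matrix_vector_mul_assoc)
    then have "matrix_norm (A x (\<sigma> * real n) - ?P ** A y (\<sigma> * real (Suc m))) \<le>
      matrix_norm (A x (\<sigma> * real n) - A ?x (\<sigma> * real (n - m)) ** A y (\<sigma> * real m)) + matrix_norm (?P ** (A ?x \<sigma> - A ?y \<sigma>) ** A y (\<sigma> * real m))"
      by (simp only: matrix_norm_add)
    also have "\<dots> \<le> real m * R + R"
    proof (rule add_mono)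
      show "matrix_norm (A x (\<sigma> * real n) - A ?x (\<sigma> * real (n - m)) ** A y (\<sigma> * real m)) \<le> real m * R"
        using Suc by simp
      have "matrix_norm (?P ** (A ?x \<sigma> - A ?y \<sigma>) ** A y (\<sigma> * real m)) \<le> matrix_norm (?P ** (A ?x \<sigma> - A ?y \<sigma>)) * matrix_norm (A y (\<sigma> * real m))"
        by (rule matrix_norm_mult)
      also have "\<dots> \<le> matrix_norm ?P * matrix_norm (A ?x \<sigma> - A ?y \<sigma>) * matrix_norm (A y (\<sigma> * real m))"
        by (intro mult_right_mono matrix_norm_mult matrix_norm_pos)
      also have "\<dots> \<le> R"
        unfolding R_def
      proof (intro mult_mono matrix_norm_pos mult_nonneg_nonneg)
        \<comment> \<open>The charges met from the shifted point onwards are part of those met from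
          \<open>x\<close>.\<close>
        have "(\<Sum>q<l. h (\<phi> (\<sigma> * real q) (\<phi> (\<sigma> * real (Suc m)) x))) = (\<Sum>q\<in>{Suc m..<n}. h (\<phi> (\<sigma> * real q) x))"
          unfolding n by (rule sum.reindex_bij_witness[of _ "\<lambda>q. q - Suc m" "\<lambda>q. q + Suc m"])
            (auto simp: flow_add algebra_simps)
        also have "\<dots> \<le> (\<Sum>q<n. h (\<phi> (\<sigma> * real q) x))"
          by (intro sum_mono2) (auto intro: h_nonneg)
        also have "\<dots> \<le> real n / 2"
          using x \<sigma> by (auto simp: seldom_bad_def)
        finally have "(c + \<epsilon>) * real l + (\<Sum>q<l. h (\<phi> (\<sigma> * real q) (\<phi> (\<sigma> * real (Suc m)) x))) \<le> (c + \<epsilon>) * real n + real n / 2"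
          using c_nonneg \<epsilon>_pos by (intro add_mono mult_left_mono) (auto simp: n)
        then show "matrix_norm ?P \<le> C1 * exp ((c + \<epsilon>) * real n + real n / 2)"
          using C1_ge_1 by (intro order_trans[OF growth[OF \<sigma>]] mult_left_mono) auto
        have "matrix_norm (A ?x \<sigma> - A ?y \<sigma>) \<le> H * dist ?x ?y powr \<nu>"
          by (rule holder[OF \<sigma>])
        also have "\<dots> \<le> H * (L ^ m * dist x y) powr \<nu>"
          using H_pos \<nu>_pos orbit_dist[OF \<sigma>] by (intro mult_left_mono powr_mono2) auto
        also have "(L ^ m * dist x y) powr \<nu> = exp (\<nu> * ln L * real m) * dist x y powr \<nu>"
          using L_ge_1 by (simp add: powr_mult powr_realpow[symmetric] powr_powr) (simp add: powr_def ac_simps)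
        also have "H * (exp (\<nu> * ln L * real m) * dist x y powr \<nu>) \<le> H * (exp (\<nu> * ln L * real n) * dist x y powr \<nu>)"
          using H_pos \<nu>_pos L_ge_1 n by (intro mult_left_mono mult_right_mono) (auto intro!: mult_left_mono)
        finally show "matrix_norm (A ?x \<sigma> - A ?y \<sigma>) \<le> H * (exp (\<nu> * ln L * real n) * dist x y powr \<nu>)" .
        have "C1 * exp ((c + \<epsilon>) * real m) \<le> C1 * exp ((c + \<epsilon>) * real n)"
          using C1_ge_1 c_nonneg \<epsilon>_pos n by (intro mult_left_mono) (auto intro!: mult_left_mono)
        with growth_good[OF y \<sigma>, of m] show "matrix_norm (A y (\<sigma> * real m)) \<le> C1 * exp ((c + \<epsilon>) * real n)"
          by linarith
      qed (use C1_ge_1 H_pos in auto)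
      finally show "matrix_norm (?P ** (A ?x \<sigma> - A ?y \<sigma>) ** A y (\<sigma> * real m)) \<le> R" .
    qed
    also have "real m * R + R = real (Suc m) * R"
      by (simp add: distrib_right)
    finally show ?case
      unfolding l_def .
  qed
  from this[of n] have "matrix_norm (A x (\<sigma> * real n) - A y (\<sigma> * real n)) \<le> real n * R"
    by (simp add: cocycle_0)
  \<comment> \<open>The number of terms is absorbed into the rate; this is the 1 contained in the 3
    / 2 of \<open>a\<close>.\<close>
  also have "\<dots> \<le> exp (real n) * R"
    using C1_ge_1 H_pos order_trans[OF _ exp_ge_add_one_self[of "real n"]] unfolding R_def
    by (intro mult_right_mono) (auto intro!: mult_nonneg_nonneg)
  also have "\<dots> = C1\<^sup>2 * H * exp (a * real n) * dist x y powr \<nu>"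
  proof -
    have "exp (a * real n) = exp (real n) * exp ((c + \<epsilon>) * real n + real n / 2) * exp (\<nu> * ln L * real n) * exp ((c + \<epsilon>) * real n)"
      unfolding exp_add[symmetric] a_def by (simp add: field_simps)
    then show ?thesis
      by (simp add: R_def power2_eq_square)
  qed
  finally show ?thesis .
qed

text \<open>The component of \<open>v\<close> is recovered from that of its image by going back in
  time. This is why the image of \<open>x\<close> has to be in \<open>G\<close>: there both the
  backward bound on \<open>E j\<close> and the projection bound hold. The size of the image of
  \<open>v\<close> is compared with that under the cocycle at \<open>y\<close>, where the growth on
  \<open>E i y\<close> is known.\<close>

lemma component_at_good_time:
  assumes \<sigma>: "\<sigma> \<in> {1, -1}" and x: "x \<in> G" "seldom_bad x" and y: "y \<in> G" and ij: "i < k" "j < k"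
    and v: "v \<in> E i y" "norm v = 1" and w: "w \<in> (\<Pi>\<^sub>E i\<in>{..<k}. E i x)" "(\<Sum>i<k. w i) = v"
    and good: "\<phi> (\<sigma> * real n) x \<in> G"
  shows "norm (w j) \<le> C\<^sup>2 * exp ((- \<sigma> * \<kappa> j + \<epsilon>) * real n) *
    (C * exp ((\<sigma> * \<kappa> i + \<epsilon>) * real n) + C1\<^sup>2 * H * exp (a * real n) * dist x y powr \<nu>)"
proof -
  let ?z = "\<phi> (\<sigma> * real n) x" and ?A = "A x (\<sigma> * real n)"
  define w' where "w' = restrict (\<lambda>l. ?A *v w l) {..<k}"
  have w': "w' \<in> (\<Pi>\<^sub>E i\<in>{..<k}. E i ?z)"
    using w(1) equivariant[OF x(1), of _ "\<sigma> * real n"] by (fastforce simp: w'_def)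
  have sum_w': "(\<Sum>i<k. w' i) = ?A *v v"
    by (simp add: w(2)[symmetric] w'_def linear_sum[OF matrix_vector_mul_linear])
  have "A ?z (- \<sigma> * real n) ** ?A = mat 1"
    using cocycle_add[of x "\<sigma> * real n" "- \<sigma> * real n"] by (simp add: cocycle_0)
  then have "w j = A ?z (- \<sigma> * real n) *v w' j"
    using ij(2) by (simp add: w'_def matrix_vector_mul_assoc)
  also have "norm \<dots> \<le> C * exp ((- \<sigma> * \<kappa> j + \<epsilon>) * real n) * norm (w' j)"
    using w' ij(2) \<sigma> by (intro upper good) auto
  also have "\<dots> \<le> C * exp ((- \<sigma> * \<kappa> j + \<epsilon>) * real n) * (C * norm (?A *v v))"
    using projection[OF good w' ij(2)] C_pos by (intro mult_left_mono) (auto simp: sum_w')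
  also have "\<dots> = C\<^sup>2 * exp ((- \<sigma> * \<kappa> j + \<epsilon>) * real n) * norm (?A *v v)"
    by (simp add: power2_eq_square)
  also have "\<dots> \<le> C\<^sup>2 * exp ((- \<sigma> * \<kappa> j + \<epsilon>) * real n) *
    (C * exp ((\<sigma> * \<kappa> i + \<epsilon>) * real n) + C1\<^sup>2 * H * exp (a * real n) * dist x y powr \<nu>)"
  proof (intro mult_left_mono)
    have "norm (?A *v v) \<le> norm (A y (\<sigma> * real n) *v v) + norm ((?A - A y (\<sigma> * real n)) *v v)"
      using norm_triangle_ineq[of "A y (\<sigma> * real n) *v v" "(?A - A y (\<sigma> * real n)) *v v"]
      by (simp add: matrix_vector_mult_diff_rdistrib)
    also have "norm (A y (\<sigma> * real n) *v v) \<le> C * exp ((\<sigma> * \<kappa> i + \<epsilon>) * real n)"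
      using upper[OF y ij(1) v(1) \<sigma>, of n] v(2) by simp
    also have "norm ((?A - A y (\<sigma> * real n)) *v v) \<le> matrix_norm (?A - A y (\<sigma> * real n))"
      using norm_matrix_vector_le[of "?A - A y (\<sigma> * real n)" v] v(2) by simp
    also note cocycle_difference[OF \<sigma> x(2) y]
    finally show "norm (?A *v v) \<le> C * exp ((\<sigma> * \<kappa> i + \<epsilon>) * real n) + C1\<^sup>2 * H * exp (a * real n) * dist x y powr \<nu>"
      by simp
  qed auto
  finally show ?thesis .
qed

section \<open>Balancing the time against the distance\<close>

lemma good_time:
  assumes "\<sigma> \<in> {1, -1}" "seldom_bad x"
  obtains n where "N \<le> n" "n \<le> 2 * N" "\<phi> (\<sigma> * real n) x \<in> G"
proof -
  have "\<exists>n\<in>{N..2 * N}. \<phi> (\<sigma> * real n) x \<in> G"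
  proof (rule ccontr)
    assume "\<not> ?thesis"
    \<comment> \<open>The window would cost at least \<open>N + 1\<close>, which exceeds the budget
      \<open>N + 1 / 2\<close> of the first \<open>2 * N + 1\<close> times.\<close>
    then have "real (card {N..2 * N}) * 1 \<le> (\<Sum>n\<in>{N..2 * N}. h (\<phi> (\<sigma> * real n) x))"
      by (intro sum_bounded_below h_ge_1) auto
    also have "\<dots> \<le> (\<Sum>n<2 * N + 1. h (\<phi> (\<sigma> * real n) x))"
      by (intro sum_mono2 h_nonneg) auto
    also have "\<dots> \<le> real (2 * N + 1) / 2"
      using assms unfolding seldom_bad_def by blast
    finally show False
      by simp
  qed
  with that show ?thesis
    by auto
qed

text \<open>The two terms of \<open>component_at_good_time\<close> are bounded by powers of the
  distance whose exponents are \<nu> times these numbers: 1 / 2 comes from the difference of the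
  cocycles, the quotient from the gap between the exponents.\<close>

definition "\<omega> = min (1 / 2) (2 * \<epsilon> / (4 * (a + c + \<epsilon>)))"

text \<open>The sign \<sigma> selects the direction of time in which \<open>E j\<close> outgrows
  \<open>E i\<close>. Of a gap \<open>4 * \<epsilon>\<close>, the errors \<epsilon> in the two rates
  still leave a net decay of rate \<open>2 * \<epsilon>\<close>.\<close>

lemma component_bound:
  assumes \<sigma>: "\<sigma> \<in> {1, -1}" and x: "x \<in> G" "seldom_bad x" and y: "y \<in> G" and ij: "i < k" "j < k"
    and gap: "4 * \<epsilon> \<le> \<sigma> * (\<kappa> j - \<kappa> i)"
    and v: "v \<in> E i y" "norm v = 1" and w: "w \<in> (\<Pi>\<^sub>E i\<in>{..<k}. E i x)" "(\<Sum>i<k. w i) = v"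
    and d: "0 < dist x y" "dist x y < 1"
  shows "norm (w j) \<le> (C ^ 3 + C\<^sup>2 * C1\<^sup>2 * H) * exp (2 * \<epsilon>) * dist x y powr (\<nu> * \<omega>)"
proof -
  define b where "b = a + c + \<epsilon>"
  have b: "0 < b"
    using c_nonneg \<epsilon>_pos \<nu>_pos L_ge_1 by (simp add: b_def a_def add_nonneg_pos add_pos_nonneg)
  let ?d = "dist x y"
  \<comment> \<open>With \<open>4 * b\<close> in the denominator, growth of rate \<open>b\<close> up
    to the latest possible time \<open>2 * q\<close> uses up only half of the exponent \<nu> of the
    distance.\<close>
  define q where "q = - \<nu> * ln ?d / (4 * b)"
  have q: "0 \<le> q"
    using b \<nu>_pos d by (simp add: q_def mult_nonneg_nonpos divide_nonpos_pos ln_le_zero_iff)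
  define N where "N = nat \<lfloor>q\<rfloor>"
  have N: "real N \<le> q" "q - 1 \<le> real N"
    using q by (simp_all add: N_def)
  obtain n where n: "N \<le> n" "n \<le> 2 * N" "\<phi> (\<sigma> * real n) x \<in> G"
    using good_time[OF \<sigma> x(2)] .
  have mono: "?d powr s \<le> ?d powr (\<nu> * \<omega>)" if "\<nu> * \<omega> \<le> s" for s
    using d that by (intro powr_mono') auto
  have "exp ((- \<sigma> * \<kappa> j + \<epsilon>) * real n) * exp ((\<sigma> * \<kappa> i + \<epsilon>) * real n)
    = exp ((2 * \<epsilon> - \<sigma> * (\<kappa> j - \<kappa> i)) * real n)"
    by (simp add: exp_add[symmetric] algebra_simps)
  also have "\<dots> \<le> exp (- (2 * \<epsilon>) * real n)"
    using gap unfolding exp_le_cancel_iff by (intro mult_right_mono) auto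
  \<comment> \<open>Rounding \<open>q\<close> down loses at most one unit of time, hence the factor
    \<open>exp (2 * \<epsilon>)\<close> in the bound.\<close>
  also have "\<dots> \<le> exp (- (2 * \<epsilon>) * (q - 1))"
    using N(2) n(1) \<epsilon>_pos by (simp add: mult_left_mono)
  also have "\<dots> = exp (2 * \<epsilon>) * ?d powr (\<nu> * (2 * \<epsilon> / (4 * b)))"
    using d by (simp add: powr_def exp_add[symmetric] q_def algebra_simps)
  also have "\<dots> \<le> exp (2 * \<epsilon>) * ?d powr (\<nu> * \<omega>)"
    using \<nu>_pos by (intro mult_left_mono mono) (auto simp: \<omega>_def b_def)
  finally have 1: "exp ((- \<sigma> * \<kappa> j + \<epsilon>) * real n) * exp ((\<sigma> * \<kappa> i + \<epsilon>) * real n) \<le> exp (2 * \<epsilon>) * ?d powr (\<nu> * \<omega>)" .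
  have "exp ((- \<sigma> * \<kappa> j + \<epsilon>) * real n) * (exp (a * real n) * ?d powr \<nu>) = exp ((- \<sigma> * \<kappa> j + \<epsilon> + a) * real n) * ?d powr \<nu>"
    by (simp add: exp_add[symmetric] algebra_simps)
  also have "\<dots> \<le> exp (b * (2 * q)) * ?d powr \<nu>"
  proof (intro mult_right_mono)
    have "- \<sigma> * \<kappa> j \<le> c"
      using abs_\<kappa>_le[OF ij(2)] \<sigma> by auto
    then have "(- \<sigma> * \<kappa> j + \<epsilon> + a) * real n \<le> b * real n"
      by (intro mult_right_mono) (auto simp: b_def)
    also have "\<dots> \<le> b * (2 * q)"
      using n(2) N(1) b by (intro mult_left_mono) linarith+
    finally show "exp ((- \<sigma> * \<kappa> j + \<epsilon> + a) * real n) \<le> exp (b * (2 * q))"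
      by simp
  qed auto
  also have "\<dots> = ?d powr (\<nu> * (1 / 2))"
    using d b by (simp add: powr_def exp_add[symmetric] q_def field_simps)
  also have "\<dots> \<le> ?d powr (\<nu> * \<omega>)"
    using \<nu>_pos by (intro mono) (auto simp: \<omega>_def)
  also have "\<dots> \<le> exp (2 * \<epsilon>) * ?d powr (\<nu> * \<omega>)"
    using \<epsilon>_pos mult_right_mono[of 1 "exp (2 * \<epsilon>)" "?d powr (\<nu> * \<omega>)"] by simp
  finally have 2: "exp ((- \<sigma> * \<kappa> j + \<epsilon>) * real n) * (exp (a * real n) * ?d powr \<nu>) \<le> exp (2 * \<epsilon>) * ?d powr (\<nu> * \<omega>)" .
  have "norm (w j) \<le> C ^ 3 * (exp ((- \<sigma> * \<kappa> j + \<epsilon>) * real n) * exp ((\<sigma> * \<kappa> i + \<epsilon>) * real n))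
    + C\<^sup>2 * C1\<^sup>2 * H * (exp ((- \<sigma> * \<kappa> j + \<epsilon>) * real n) * (exp (a * real n) * ?d powr \<nu>))"
    using component_at_good_time[OF \<sigma> x y ij v w n(3)] by (simp add: algebra_simps power3_eq_cube power2_eq_square)
  also have "\<dots> \<le> C ^ 3 * (exp (2 * \<epsilon>) * ?d powr (\<nu> * \<omega>)) + C\<^sup>2 * C1\<^sup>2 * H * (exp (2 * \<epsilon>) * ?d powr (\<nu> * \<omega>))"
    using 1 2 C_pos H_pos by (intro add_mono mult_left_mono) auto
  finally show ?thesis
    by (simp add: algebra_simps)
qed

definition "C2 = real k * ((C ^ 3 + C\<^sup>2 * C1\<^sup>2 * H) * exp (2 * \<epsilon>))"

lemma infdist_bound:
  assumes x: "x \<in> G" "seldom_bad x" and y: "y \<in> G" and i: "i < k"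
    and gap: "\<And>j. \<lbrakk>j < k; j \<noteq> i\<rbrakk> \<Longrightarrow> 4 * \<epsilon> \<le> \<bar>\<kappa> j - \<kappa> i\<bar>"
    and v: "v \<in> E i y" "norm v = 1" and d: "0 < dist x y" "dist x y < 1"
  shows "infdist v (E i x) \<le> C2 * dist x y powr (\<nu> * \<omega>)"
proof -
  obtain w where w: "w \<in> (\<Pi>\<^sub>E i\<in>{..<k}. E i x)" "(\<Sum>i<k. w i) = v"
    using decomposition[OF x(1)] .
  let ?R = "(C ^ 3 + C\<^sup>2 * C1\<^sup>2 * H) * exp (2 * \<epsilon>) * dist x y powr (\<nu> * \<omega>)"
  have "norm (w j) \<le> ?R" if "j \<in> {..<k} - {i}" for j
  proof -
    \<comment> \<open>Faster components are estimated in forward time, slower ones in backward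
      time.\<close>
    let ?\<sigma> = "sgn (\<kappa> j - \<kappa> i)"
    have *: "4 * \<epsilon> \<le> \<bar>\<kappa> j - \<kappa> i\<bar>"
      using gap that by auto
    then have "?\<sigma> \<in> {1, -1}"
      using \<epsilon>_pos by (auto simp: sgn_if)
    moreover have "4 * \<epsilon> \<le> ?\<sigma> * (\<kappa> j - \<kappa> i)"
      using * by (simp add: sgn_mult_self_eq[symmetric] linordered_idom_class.abs_sgn mult.commute)
    ultimately show ?thesis
      using that by (intro component_bound[OF _ x y i _ _ v w d]) auto
  qed
  then have "norm (\<Sum>j\<in>{..<k} - {i}. w j) \<le> (\<Sum>j\<in>{..<k} - {i}. ?R)"
    by (rule sum_norm_le)
  also have "\<dots> \<le> real k * ?R"
    using C_pos H_pos i by (auto intro!: mult_right_mono)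
  also have "(\<Sum>j\<in>{..<k} - {i}. w j) = v - w i"
    using w(2) i by (simp add: sum_diff1)
  finally have "dist v (w i) \<le> real k * ?R"
    by (simp add: dist_norm)
  moreover have "infdist v (E i x) \<le> dist v (w i)"
    using w(1) i by (intro infdist_le) auto
  ultimately show ?thesis
    by (simp add: C2_def mult.assoc)
qed

text \<open>The budget for n = 1 is \<open>h x \<le> 1 / 2\<close>, below the price of a point
  outside of \<open>G\<close>.\<close>

lemma seldom_bad_good: "seldom_bad x \<Longrightarrow> x \<in> G"
  using h_ge_1[of x] unfolding seldom_bad_def by (force simp: flow_0 dest!: spec[of _ 1])

lemma C2_nonneg: "0 \<le> C2"
  using C_pos H_pos by (simp add: C2_def)

lemma \<omega>_bounds: "0 < \<omega>" "\<omega> < 1"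
proof -
  have "0 < a + c + \<epsilon>"
    using c_nonneg \<epsilon>_pos \<nu>_pos L_ge_1 by (simp add: a_def add_nonneg_pos add_pos_nonneg)
  then show "0 < \<omega>" "\<omega> < 1"
    using \<epsilon>_pos by (auto simp: \<omega>_def)
qed

lemma subspace_dist_bound:
  assumes x: "seldom_bad x" and y: "seldom_bad y" and i: "i < k"
    and gap: "\<And>j. \<lbrakk>j < k; j \<noteq> i\<rbrakk> \<Longrightarrow> 4 * \<epsilon> \<le> \<bar>\<kappa> j - \<kappa> i\<bar>"
    and d: "dist x y < 1"
  shows "subspace_dist (E i x) (E i y) \<le> C2 * dist x y powr (\<nu> * \<omega>)"
proof -
  note G = seldom_bad_good[OF x] seldom_bad_good[OF y]
  have sub: "subspace (E i x)" "subspace (E i y)"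
    using splitting[OF G(1)] splitting[OF G(2)] i by (auto simp: direct_sum_splitting_def)
  show ?thesis
  \<comment> \<open>The choice of the time takes the logarithm of the distance, so coinciding points
    are treated apart; both sides are then 0.\<close>
  proof (cases "x = y")
    case True
    then show ?thesis
      using sub nonzero[OF G(1) i] by (intro subspace_dist_le) auto
  next
    case False
    then show ?thesis
      using sub nonzero[OF G(1) i] nonzero[OF G(2) i] d infdist_bound[OF G(1) x G(2) i gap]
        infdist_bound[OF G(2) y G(1) i gap]
      by (intro subspace_dist_le) (auto simp: dist_commute)
  qed
qed

end

section \<open>Regular points\<close>

text \<open>Uniform boundedness in finite dimension: the bounds on an orthonormal basis of
  \<open>S\<close> add up. This turns the limits for single vectors in Oseledets' theorem into
  bounds on a whole subspace.\<close>

lemma subspace_uniform_bound: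
  fixes T :: "nat \<Rightarrow> 'a::euclidean_space \<Rightarrow> 'b::real_normed_vector"
  assumes S: "subspace S" and T: "\<And>n. linear (T n)" and c: "\<And>n. 0 \<le> c n"
    and bd: "\<And>v. v \<in> S \<Longrightarrow> \<exists>K. \<forall>n. norm (T n v) \<le> K * c n"
  obtains K where "\<And>n v. v \<in> S \<Longrightarrow> norm (T n v) \<le> K * c n * norm v"
proof -
  obtain B where B: "B \<subseteq> S" "pairwise orthogonal B" "\<And>x. x \<in> B \<Longrightarrow> norm x = 1"
    "independent B" "span B = S"
    using orthonormal_basis_subspace[OF S] by metis
  have fin: "finite B"
    using B(4) independent_imp_finite by blast
  obtain K where K: "\<And>b n. b \<in> B \<Longrightarrow> norm (T n b) \<le> K b * c n"
    using bd B(1) by (metis subsetD)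
  have "norm (T n v) \<le> (\<Sum>b\<in>B. \<bar>K b\<bar>) * c n * norm v" if v: "v \<in> S" for n v
  proof -
    have "v = (\<Sum>b\<in>B. (v \<bullet> b) *\<^sub>R b)"
    proof -
      obtain q where q: "v = (\<Sum>b\<in>B. q b *\<^sub>R b)"
        using v B(5) by (auto simp: span_finite[OF fin])
      have "v \<bullet> b = q b" if b: "b \<in> B" for b
      proof -
        have "v \<bullet> b = (\<Sum>a\<in>B. q a * (a \<bullet> b))"
          by (simp add: q inner_sum_left)
        also have "\<dots> = (\<Sum>a\<in>B. if a = b then q b else 0)"
          using B(2,3) b by (intro sum.cong) (auto simp: pairwise_def orthogonal_def dot_square_norm)
        finally show ?thesis
          using fin b by simp
      qed
      with q show ?thesis
        by (metis (mono_tags, lifting) sum.cong)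
    qed
    then have "T n v = (\<Sum>b\<in>B. (v \<bullet> b) *\<^sub>R T n b)"
      using linear_sum[OF T] linear_scale[OF T] by (metis (mono_tags, lifting) sum.cong)
    then have "norm (T n v) \<le> (\<Sum>b\<in>B. norm v * (\<bar>K b\<bar> * c n))"
    proof (simp only:, intro sum_norm_le)
      fix b assume b: "b \<in> B"
      have "\<bar>v \<bullet> b\<bar> \<le> norm v"
        using Cauchy_Schwarz_ineq2[of v b] B(3)[OF b] by simp
      moreover have "norm (T n b) \<le> \<bar>K b\<bar> * c n"
        using K[OF b, of n] c[of n] by (meson abs_ge_self mult_right_mono order_trans)
      ultimately show "norm ((v \<bullet> b) *\<^sub>R T n b) \<le> norm v * (\<bar>K b\<bar> * c n)"
        by (simp add: mult_mono)
    qed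
    also have "\<dots> = (\<Sum>b\<in>B. \<bar>K b\<bar>) * c n * norm v"
      by (simp add: sum_distrib_left sum_distrib_right ac_simps)
    finally show ?thesis .
  qed
  with that show ?thesis
    by blast
qed

text \<open>The finitely many terms before the estimate sets in are absorbed into the
  constant.\<close>

lemma exponential_bound:
  fixes s :: "nat \<Rightarrow> real"
  assumes s: "eventually (\<lambda>n. s n \<le> exp (r * real n)) sequentially"
  shows "\<exists>K. \<forall>n. s n \<le> K * exp (r * real n)"
proof -
  obtain N where N: "\<And>n. N \<le> n \<Longrightarrow> s n \<le> exp (r * real n)"
    using s by (auto simp: eventually_sequentially)
  define K where "K = 1 + (\<Sum>m<N. \<bar>s m\<bar> * exp (- r * real m))"
  have K: "1 \<le> K"
    by (simp add: K_def sum_nonneg)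
  have "s n \<le> K * exp (r * real n)" for n
  proof (cases "n < N")
    case True
    then have "\<bar>s n\<bar> * exp (- r * real n) \<le> K"
      unfolding K_def using member_le_sum[of n "{..<N}" "\<lambda>m. \<bar>s m\<bar> * exp (- r * real m)"] by simp
    then have "\<bar>s n\<bar> * exp (- r * real n) * exp (r * real n) \<le> K * exp (r * real n)"
      by (rule mult_right_mono) simp
    then show ?thesis
      by (simp add: mult.assoc exp_add[symmetric])
  next
    case False
    then have "s n \<le> 1 * exp (r * real n)"
      using N by simp
    also have "\<dots> \<le> K * exp (r * real n)"
      using K by (rule mult_right_mono) simp
    finally show ?thesis .
  qed
  then show ?thesis
    by blast
qed

lemma exponent_bound:
  fixes s :: "real \<Rightarrow> real"
  assumes s: "\<And>t. 0 < s t" and \<sigma>: "\<sigma> \<in> {1, -1}" and \<epsilon>: "0 < \<epsilon>"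
    and lim: "((\<lambda>t. 1 / t * ln (s t)) \<longlongrightarrow> \<kappa>) at_top" "((\<lambda>t. 1 / t * ln (s t)) \<longlongrightarrow> \<kappa>) at_bot"
  shows "\<exists>K. \<forall>n. s (\<sigma> * real n) \<le> K * exp ((\<sigma> * \<kappa> + \<epsilon>) * real n)"
proof (rule exponential_bound)
  have "filterlim (\<lambda>n. \<sigma> * real n) (if \<sigma> = 1 then at_top else at_bot) sequentially"
    using \<sigma> filterlim_real_sequentially by (auto simp: filterlim_uminus_at_top)
  moreover have "((\<lambda>t. 1 / t * ln (s t)) \<longlongrightarrow> \<kappa>) (if \<sigma> = 1 then at_top else at_bot)"
    using lim by simp
  ultimately have "(\<lambda>n. 1 / (\<sigma> * real n) * ln (s (\<sigma> * real n))) \<longlonglongrightarrow> \<kappa>"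
    by (rule filterlim_compose[rotated])
  then have "eventually (\<lambda>n. dist (1 / (\<sigma> * real n) * ln (s (\<sigma> * real n))) \<kappa> < \<epsilon>) sequentially"
    using \<epsilon> by (rule tendstoD)
  then show "eventually (\<lambda>n. s (\<sigma> * real n) \<le> exp ((\<sigma> * \<kappa> + \<epsilon>) * real n)) sequentially"
    using eventually_gt_at_top[of 0]
  proof eventually_elim
    case (elim n)
    let ?l = "ln (s (\<sigma> * real n))"
    \<comment> \<open>Multiplying by \<sigma> undoes the sign of the time, so that the rate becomes
      \<open>\<sigma> * \<kappa>\<close> in either direction.\<close>
    have "\<sigma> * (1 / (\<sigma> * real n) * ?l - \<kappa>) < \<epsilon>"
      using elim(1) \<sigma> by (auto simp: dist_real_def abs_less_iff)
    moreover have "\<sigma> * (1 / (\<sigma> * real n) * ?l) = ?l / real n"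
      using \<sigma> by auto
    ultimately have "?l / real n \<le> \<sigma> * \<kappa> + \<epsilon>"
      by (simp add: right_diff_distrib)
    then have "?l \<le> (\<sigma> * \<kappa> + \<epsilon>) * real n"
      using elim(2) by (simp add: field_simps)
    then show ?case
      using s by (metis exp_le_cancel_iff exp_ln)
  qed
qed

text \<open>Uniqueness of the decomposition makes each component a linear function of the vector,
  and linear maps in finite dimension are bounded.\<close>

lemma direct_sum_projection_bound:
  fixes V :: "nat \<Rightarrow> (real ^ 'n) set"
  assumes "direct_sum_splitting k V"
  obtains K where "\<And>w i. \<lbrakk>w \<in> (\<Pi>\<^sub>E i\<in>{..<k}. V i); i < k\<rbrakk> \<Longrightarrow> norm (w i) \<le> K * norm (\<Sum>i<k. w i)"
proof -
  let ?P = "\<Pi>\<^sub>E i\<in>{..<k}. V i"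
  have sub: "\<And>i. i < k \<Longrightarrow> subspace (V i)"
    and ex1: "\<exists>!w. w \<in> ?P \<and> (\<Sum>i<k. w i) = v" for v
    using assms by (auto simp: direct_sum_splitting_def)
  define p where "p v = (THE w. w \<in> ?P \<and> (\<Sum>i<k. w i) = v)" for v
  have p: "p v \<in> ?P" "(\<Sum>i<k. p v i) = v" for v
    using theI'[OF ex1[of v]] by (auto simp: p_def)
  have p_eq: "p (\<Sum>i<k. w i) = w" if "w \<in> ?P" for w
    unfolding p_def using that ex1 by (intro the1_equality) auto
  have lin: "linear (\<lambda>v. p v i)" if i: "i < k" for i
  proof (rule linearI)
    fix u v :: "real ^ 'n" and r :: real
    let ?w = "\<lambda>i\<in>{..<k}. p u i + p v i" and ?w' = "\<lambda>i\<in>{..<k}. r *\<^sub>R p u i"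
    have "?w \<in> ?P" "?w' \<in> ?P"
      using p(1)[of u] p(1)[of v] sub by (auto intro!: subspace_add subspace_scale simp: PiE_iff)
    from p_eq[OF this(1)] p_eq[OF this(2)] have "p (u + v) = ?w" "p (r *\<^sub>R u) = ?w'"
      by (simp_all add: sum.distrib p(2) flip: scaleR_sum_right)
    with i show "p (u + v) i = p u i + p v i" "p (r *\<^sub>R u) i = r *\<^sub>R p u i"
      by simp_all
  qed
  have "\<exists>B. \<forall>v. norm (p v i) \<le> B * norm v" if "i < k" for i
    using linear_bounded[OF lin[OF that]] .
  then obtain B where B: "\<And>i v. i < k \<Longrightarrow> norm (p v i) \<le> B i * norm v"
    by metis
  have "norm (w i) \<le> (\<Sum>i<k. \<bar>B i\<bar>) * norm (\<Sum>i<k. w i)" if w: "w \<in> ?P" and i: "i < k" for w i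
  proof -
    have "norm (w i) \<le> B i * norm (\<Sum>i<k. w i)"
      using B[OF i, of "\<Sum>i<k. w i"] p_eq[OF w] by simp
    also have "\<dots> \<le> (\<Sum>i<k. \<bar>B i\<bar>) * norm (\<Sum>i<k. w i)"
      using i member_le_sum[of i "{..<k}" "\<lambda>i. \<bar>B i\<bar>"] by (intro mult_right_mono) auto
    finally show ?thesis .
  qed
  with that show ?thesis
    by blast
qed

text \<open>These are the estimates \<open>upper\<close> and \<open>projection\<close> of
  \<open>regular_block\<close> at one point. With a single constant for both, the set of points
  where they hold grows with \<open>C\<close>, and integer values of \<open>C\<close> suffice to
  exhaust the points with a splitting and limits as in Oseledets' theorem.\<close>

definition regular_at :: "('a \<Rightarrow> real \<Rightarrow> real ^ 'n ^ 'n) \<Rightarrow> nat \<Rightarrow> (nat \<Rightarrow> real) \<Rightarrow> real \<Rightarrow>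
    (nat \<Rightarrow> 'a \<Rightarrow> (real ^ 'n) set) \<Rightarrow> real \<Rightarrow> 'a \<Rightarrow> bool" where
  "regular_at A k \<kappa> \<epsilon> E C x \<longleftrightarrow>
    (\<forall>i<k. \<forall>\<sigma>\<in>{1, -1}. \<forall>n. \<forall>v\<in>E i x.
       norm (A x (\<sigma> * real n) *v v) \<le> C * exp ((\<sigma> * \<kappa> i + \<epsilon>) * real n) * norm v) \<and>
    (\<forall>w\<in>\<Pi>\<^sub>E i\<in>{..<k}. E i x. \<forall>i<k. norm (w i) \<le> C * norm (\<Sum>i<k. w i))"

lemma regular_at_mono:
  assumes "regular_at A k \<kappa> \<epsilon> E C x" "C \<le> C'"
  shows "regular_at A k \<kappa> \<epsilon> E C' x"
  unfolding regular_at_def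
proof (intro conjI allI impI ballI)
  fix i \<sigma> n v assume "i < k" "\<sigma> \<in> {1, -1 :: real}" "v \<in> E i x"
  then have "norm (A x (\<sigma> * real n) *v v) \<le> C * exp ((\<sigma> * \<kappa> i + \<epsilon>) * real n) * norm v"
    using assms(1) unfolding regular_at_def by blast
  also have "\<dots> \<le> C' * exp ((\<sigma> * \<kappa> i + \<epsilon>) * real n) * norm v"
    using assms(2) by (intro mult_right_mono) auto
  finally show "norm (A x (\<sigma> * real n) *v v) \<le> C' * exp ((\<sigma> * \<kappa> i + \<epsilon>) * real n) * norm v" .
next
  fix w i assume "w \<in> (\<Pi>\<^sub>E i\<in>{..<k}. E i x)" "i < k"
  then have "norm (w i) \<le> C * norm (\<Sum>i<k. w i)"
    using assms(1) unfolding regular_at_def by blast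
  also have "\<dots> \<le> C' * norm (\<Sum>i<k. w i)"
    using assms(2) by (intro mult_right_mono) auto
  finally show "norm (w i) \<le> C' * norm (\<Sum>i<k. w i)" .
qed

lemma regular_at_exists:
  fixes A :: "'a \<Rightarrow> real \<Rightarrow> real ^ 'n ^ 'n"
  assumes inv: "\<And>t. invertible (A x t)" and \<epsilon>: "0 < \<epsilon>"
    and split: "direct_sum_splitting k (\<lambda>i. E i x)"
    and lim: "\<And>i v. \<lbrakk>i < k; v \<in> E i x - {0}\<rbrakk> \<Longrightarrow>
      ((\<lambda>t. 1 / t * ln (norm (A x t *v v))) \<longlongrightarrow> \<kappa> i) at_top \<and>
      ((\<lambda>t. 1 / t * ln (norm (A x t *v v))) \<longlongrightarrow> \<kappa> i) at_bot"
  obtains m :: nat where "regular_at A k \<kappa> \<epsilon> E (real m) x"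
proof -
  have "\<exists>K. \<forall>n. \<forall>v\<in>E i x. norm (A x (\<sigma> * real n) *v v) \<le> K * exp ((\<sigma> * \<kappa> i + \<epsilon>) * real n) * norm v"
    if i: "i < k" and \<sigma>: "\<sigma> \<in> {1, -1}" for i \<sigma>
  proof -
    have sub: "subspace (E i x)"
      using split i by (simp add: direct_sum_splitting_def)
    have bd: "\<exists>K. \<forall>n. norm (A x (\<sigma> * real n) *v v) \<le> K * exp ((\<sigma> * \<kappa> i + \<epsilon>) * real n)" if v: "v \<in> E i x" for v
    proof (cases "v = 0")
      case True
      then show ?thesis
        by (intro exI[of _ 0]) simp
    next
      case False
      have "0 < norm (A x t *v v)" for t
        using False inv[of t] matrix_left_invertible_ker unfolding invertible_def by (metis zero_less_norm_iff)
      then show ?thesis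
        using exponent_bound[of "\<lambda>t. norm (A x t *v v)", OF _ \<sigma> \<epsilon>] lim[OF i] v False by blast
    qed
    obtain K where "\<And>n v. v \<in> E i x \<Longrightarrow>
      norm (A x (\<sigma> * real n) *v v) \<le> K * exp ((\<sigma> * \<kappa> i + \<epsilon>) * real n) * norm v"
      by (rule subspace_uniform_bound[OF sub, of "\<lambda>n. (*v) (A x (\<sigma> * real n))"
            "\<lambda>n. exp ((\<sigma> * \<kappa> i + \<epsilon>) * real n)"]) (use bd in auto)
    then show ?thesis
      by blast
  qed
  then obtain K where K: "\<And>i \<sigma> n v. \<lbrakk>i < k; \<sigma> \<in> {1, -1}; v \<in> E i x\<rbrakk> \<Longrightarrow>
    norm (A x (\<sigma> * real n) *v v) \<le> K i \<sigma> * exp ((\<sigma> * \<kappa> i + \<epsilon>) * real n) * norm v"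
    by metis
  obtain K' where K': "\<And>w i. \<lbrakk>w \<in> (\<Pi>\<^sub>E i\<in>{..<k}. E i x); i < k\<rbrakk> \<Longrightarrow> norm (w i) \<le> K' * norm (\<Sum>i<k. w i)"
    using direct_sum_projection_bound[OF split] by blast
  define K2 where "K2 = (\<Sum>p\<in>{..<k} \<times> {1, -1}. \<bar>K (fst p) (snd p)\<bar>)"
  have K2: "K i \<sigma> \<le> K2" if "i < k" "\<sigma> \<in> {1, -1}" for i \<sigma>
    unfolding K2_def using member_le_sum[of "(i, \<sigma>)" "{..<k} \<times> {1, -1}" "\<lambda>p. \<bar>K (fst p) (snd p)\<bar>"] that by fastforce
  obtain m :: nat where m: "max K2 K' \<le> real m"
    using real_arch_simple by blast
  have "regular_at A k \<kappa> \<epsilon> E (max K2 K') x"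
    unfolding regular_at_def
  proof (intro conjI allI impI ballI)
    fix i \<sigma> n v assume *: "i < k" "\<sigma> \<in> {1, -1 :: real}" "v \<in> E i x"
    have "norm (A x (\<sigma> * real n) *v v) \<le> K i \<sigma> * (exp ((\<sigma> * \<kappa> i + \<epsilon>) * real n) * norm v)"
      using K[OF *] by (simp add: mult.assoc)
    also have "\<dots> \<le> max K2 K' * (exp ((\<sigma> * \<kappa> i + \<epsilon>) * real n) * norm v)"
      using K2[OF *(1,2)] by (intro mult_right_mono) auto
    finally show "norm (A x (\<sigma> * real n) *v v) \<le> max K2 K' * exp ((\<sigma> * \<kappa> i + \<epsilon>) * real n) * norm v"
      by (simp add: mult.assoc)
  next
    fix w i assume "w \<in> (\<Pi>\<^sub>E i\<in>{..<k}. E i x)" "i < k"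
    from K'[OF this] show "norm (w i) \<le> max K2 K' * norm (\<Sum>i<k. w i)"
      by (rule order_trans) (simp add: mult_right_mono)
  qed
  then show ?thesis
    by (intro that[of m] regular_at_mono[OF _ m])
qed

section \<open>Measurability of regularity\<close>

lemma countable_dense:
  obtains D :: "'a::{second_countable_topology, metric_space} set" where "countable D" "closure D = UNIV"
proof -
  obtain D :: "'a set" where D: "countable D" "\<And>X. open X \<Longrightarrow> X \<noteq> {} \<Longrightarrow> \<exists>d\<in>D. d \<in> X"
    using countable_dense_setE by blast
  have "x \<in> closure D" for x
    unfolding closure_approachable
    using D(2)[of "ball x e" for e] by (metis centre_in_ball dist_commute empty_iff mem_ball open_ball)
  with D(1) that show ?thesis
    by blast
qed

text \<open>This and the next lemma reduce a condition on all vectors of a varying subspace to countably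
  many inequalities between measurable functions.\<close>

lemma nonpos_on_closed_iff_dense:
  fixes F :: "'a::euclidean_space \<Rightarrow> real"
  assumes V: "closed V" "V \<noteq> {}" and F: "l-lipschitz_on UNIV F" and D: "closure D = UNIV"
  shows "(\<forall>v\<in>V. F v \<le> 0) \<longleftrightarrow> (\<forall>v\<in>D. F v \<le> l * infdist v V)"
proof
  assume *: "\<forall>v\<in>V. F v \<le> 0"
  show "\<forall>v\<in>D. F v \<le> l * infdist v V"
  proof
    fix v
    obtain u where u: "u \<in> V" "infdist v V = dist v u"
      using infdist_attains_inf[OF V] by blast
    have "F v - F u \<le> l * dist v u"
      using lipschitz_onD[OF F, of v u] by (simp add: dist_real_def)
    with * u show "F v \<le> l * infdist v V"
      by fastforce
  qed
next
  assume *: "\<forall>v\<in>D. F v \<le> l * infdist v V"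
  have "continuous_on UNIV F"
    using F by (rule lipschitz_on_continuous_on)
  then have "closed {v. F v \<le> l * infdist v V}"
    by (intro closed_Collect_le continuous_intros)
  with * have "closure D \<subseteq> {v. F v \<le> l * infdist v V}"
    by (intro closure_minimal) auto
  with D have "F v \<le> l * infdist v V" for v
    by auto
  then show "\<forall>v\<in>V. F v \<le> 0"
    by (metis infdist_zero mult_zero_right)
qed

lemma projection_bound_iff_dense:
  fixes V :: "nat \<Rightarrow> 'a::euclidean_space set"
  assumes V: "\<And>i. i < k \<Longrightarrow> closed (V i)" "\<And>i. i < k \<Longrightarrow> V i \<noteq> {}" and D: "closure D = UNIV" and C: "0 \<le> C"
  shows "(\<forall>w\<in>\<Pi>\<^sub>E i\<in>{..<k}. V i. \<forall>j<k. norm (w j) \<le> C * norm (\<Sum>i<k. w i)) \<longleftrightarrow>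
    (\<forall>w\<in>\<Pi>\<^sub>E i\<in>{..<k}. D. \<forall>j<k. norm (w j) \<le> C * norm (\<Sum>i<k. w i) + (1 + C) * (\<Sum>i<k. infdist (w i) (V i)))"
    (is "?L \<longleftrightarrow> ?R")
proof
  assume L: ?L
  show ?R
  proof (intro ballI allI impI)
    fix w j assume j: "j < k"
    have "\<exists>u. u \<in> V i \<and> infdist (w i) (V i) = dist (w i) u" if "i < k" for i
      using infdist_attains_inf[OF V(1) V(2)] that by metis
    then obtain u where u: "\<And>i. i < k \<Longrightarrow> u i \<in> V i" "\<And>i. i < k \<Longrightarrow> infdist (w i) (V i) = dist (w i) (u i)"
      by metis
    let ?S = "\<Sum>i<k. infdist (w i) (V i)"
    have "restrict u {..<k} \<in> (\<Pi>\<^sub>E i\<in>{..<k}. V i)"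
      using u(1) by auto
    then have "norm (restrict u {..<k} j) \<le> C * norm (\<Sum>i<k. restrict u {..<k} i)"
      using L j by blast
    then have 1: "norm (u j) \<le> C * norm (\<Sum>i<k. u i)"
      using j by simp
    \<comment> \<open>Passing to nearest points changes the sum by at most \<open>?S\<close> and the
      single vector by at most \<open>?S\<close>, whence the factor \<open>1 + C\<close>.\<close>
    have "norm (\<Sum>i<k. u i - w i) \<le> ?S"
      by (intro sum_norm_le) (auto simp: u(2) dist_norm norm_minus_commute)
    then have "norm (\<Sum>i<k. u i) \<le> norm (\<Sum>i<k. w i) + ?S"
      using norm_triangle_ineq[of "\<Sum>i<k. w i" "\<Sum>i<k. u i - w i"] by (simp add: sum_subtractf)
    then have 2: "C * norm (\<Sum>i<k. u i) \<le> C * (norm (\<Sum>i<k. w i) + ?S)"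
      using C by (rule mult_left_mono)
    have "norm (w j) \<le> norm (u j) + infdist (w j) (V j)"
      using u(2)[OF j] norm_triangle_ineq[of "u j" "w j - u j"] by (simp add: dist_norm)
    moreover have "infdist (w j) (V j) \<le> ?S"
      using j by (intro member_le_sum) (auto simp: infdist_nonneg)
    ultimately show "norm (w j) \<le> C * norm (\<Sum>i<k. w i) + (1 + C) * ?S"
      using 1 2 by (simp add: algebra_simps)
  qed
next
  assume R: ?R
  show ?L
  proof (intro ballI allI impI)
    fix w j assume w: "w \<in> (\<Pi>\<^sub>E i\<in>{..<k}. V i)" and j: "j < k"
    have "\<exists>s. (\<forall>m. s m \<in> D) \<and> s \<longlonglongrightarrow> w i" for i
      using D closure_sequential[of "w i" D] by auto
    then obtain s where s: "\<And>i m. s i m \<in> D" "\<And>i. s i \<longlonglongrightarrow> w i"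
      by metis
    have "norm (s j m) \<le> C * norm (\<Sum>i<k. s i m) + (1 + C) * (\<Sum>i<k. infdist (s i m) (V i))" for m
    proof -
      have "(\<lambda>i\<in>{..<k}. s i m) \<in> (\<Pi>\<^sub>E i\<in>{..<k}. D)"
        using s(1) by auto
      then have "norm ((\<lambda>i\<in>{..<k}. s i m) j) \<le> C * norm (\<Sum>i<k. (\<lambda>i\<in>{..<k}. s i m) i) +
        (1 + C) * (\<Sum>i<k. infdist ((\<lambda>i\<in>{..<k}. s i m) i) (V i))"
        using R j by blast
      then show ?thesis
        using j by simp
    qed
    moreover have "(\<lambda>m. norm (s j m)) \<longlonglongrightarrow> norm (w j)"
      by (intro tendsto_intros s)
    moreover have "(\<lambda>m. C * norm (\<Sum>i<k. s i m) + (1 + C) * (\<Sum>i<k. infdist (s i m) (V i)))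
      \<longlonglongrightarrow> C * norm (\<Sum>i<k. w i) + (1 + C) * (\<Sum>i<k. infdist (w i) (V i))"
      by (intro tendsto_intros s)
    ultimately have "norm (w j) \<le> C * norm (\<Sum>i<k. w i) + (1 + C) * (\<Sum>i<k. infdist (w i) (V i))"
      by (meson LIMSEQ_le)
    moreover have "(\<Sum>i<k. infdist (w i) (V i)) = 0"
      using w by (intro sum.neutral) (auto simp: PiE_iff)
    ultimately show "norm (w j) \<le> C * norm (\<Sum>i<k. w i)"
      by simp
  qed
qed

text \<open>Subadditivity and the bound by the sum of the entries make the operator norm Lipschitz
  for the Frobenius norm of the type, hence continuous.\<close>

lemma matrix_norm_measurable [measurable]:
  "(\<lambda>B :: real ^ 'n ^ 'n. matrix_norm B) \<in> borel_measurable borel"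
proof -
  have "matrix_norm B \<le> real CARD('n) * (real CARD('n) * norm B)" for B :: "real ^ 'n ^ 'n"
  proof -
    have "matrix_norm B \<le> (\<Sum>i\<in>UNIV. \<Sum>j\<in>UNIV. \<bar>B $ i $ j\<bar>)"
      by (rule onorm_le_matrix_component_sum)
    also have "\<dots> \<le> (\<Sum>i\<in>(UNIV :: 'n set). \<Sum>j\<in>(UNIV :: 'n set). norm B)"
      by (intro sum_mono) (meson Finite_Cartesian_Product.norm_nth_le component_le_norm_cart order_trans)
    finally show ?thesis
      by simp
  qed
  moreover have "matrix_norm B \<le> matrix_norm D + matrix_norm (B - D)" for B D :: "real ^ 'n ^ 'n"
    using matrix_norm_add[of D "B - D"] by simp
  ultimately have *: "matrix_norm B \<le> matrix_norm D + real CARD('n) * (real CARD('n) * norm (B - D))" for B D :: "real ^ 'n ^ 'n"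
    by (meson add_left_mono order_trans)
  have "(real CARD('n) * real CARD('n))-lipschitz_on UNIV (\<lambda>B :: real ^ 'n ^ 'n. matrix_norm B)"
  proof (rule lipschitz_onI)
    fix B D :: "real ^ 'n ^ 'n"
    show "dist (matrix_norm B) (matrix_norm D) \<le> real CARD('n) * real CARD('n) * dist B D"
      using *[of B D] *[of D B] by (simp add: dist_real_def dist_norm norm_minus_commute abs_le_iff algebra_simps)
  qed simp
  then show ?thesis
    by (intro borel_measurable_continuous_onI lipschitz_on_continuous_on)
qed

lemma regular_at_measurable:
  fixes A :: "'a \<Rightarrow> real \<Rightarrow> real ^ 'n ^ 'n"
  assumes A [measurable]: "\<And>t. (\<lambda>x. A x t) \<in> borel_measurable N"
    and E: "\<And>i v. i < k \<Longrightarrow> (\<lambda>x. infdist v (E i x)) \<in> borel_measurable N" and C: "0 \<le> C"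
    and X: "X \<in> sets N" "\<And>x i. \<lbrakk>x \<in> X; i < k\<rbrakk> \<Longrightarrow> subspace (E i x)"
  shows "{x \<in> X. regular_at A k \<kappa> \<epsilon> E C x} \<in> sets N"
proof -
  obtain D :: "(real ^ 'n) set" where D: "countable D" "closure D = UNIV"
    using countable_dense .
  define c where "c i \<sigma> n = C * exp ((\<sigma> * \<kappa> i + \<epsilon>) * real n)" for i and \<sigma> :: real and n :: nat
  have c: "0 \<le> c i \<sigma> n" for i \<sigma> n
    using C by (simp add: c_def)
  define P where "P i \<sigma> n v x \<longleftrightarrow> norm (A x (\<sigma> * real n) *v v) - c i \<sigma> n * norm v \<le>
    (matrix_norm (A x (\<sigma> * real n)) + c i \<sigma> n) * infdist v (E i x)" for i \<sigma> n v x
  define Q where "Q w j x \<longleftrightarrow> norm (w j) \<le> C * norm (\<Sum>i<k. w i) + (1 + C) * (\<Sum>i<k. infdist (w i) (E i x))"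
    for w :: "nat \<Rightarrow> real ^ 'n" and j x
  \<comment> \<open>This Lipschitz constant is the factor of \<open>infdist\<close> in
    \<open>P\<close>. It varies with the point, but measurably.\<close>
  have lip: "(matrix_norm B + r)-lipschitz_on UNIV (\<lambda>v. norm (B *v v) - r * norm v)" if "0 \<le> r" for B :: "real ^ 'n ^ 'n" and r
  proof (rule lipschitz_onI)
    fix u v
    have "\<bar>norm (B *v u) - norm (B *v v)\<bar> \<le> norm (B *v (u - v))"
      by (simp add: matrix_vector_mult_diff_distrib norm_triangle_ineq3)
    also have "\<dots> \<le> matrix_norm B * norm (u - v)"
      by (rule norm_matrix_vector_le)
    finally have 1: "\<bar>norm (B *v u) - norm (B *v v)\<bar> \<le> matrix_norm B * norm (u - v)" .
    have 2: "\<bar>r * norm u - r * norm v\<bar> \<le> r * norm (u - v)"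
      using that mult_left_mono[OF norm_triangle_ineq3[of u v] that] by (simp add: abs_mult flip: right_diff_distrib)
    from 1 2 show "dist (norm (B *v u) - r * norm u) (norm (B *v v) - r * norm v) \<le> (matrix_norm B + r) * dist u v"
      by (simp add: dist_real_def dist_norm distrib_right abs_le_iff)
  qed (use that in \<open>simp add: matrix_norm_pos\<close>)
  have "regular_at A k \<kappa> \<epsilon> E C x \<longleftrightarrow> (\<forall>i\<in>{..<k}. \<forall>\<sigma>\<in>{1, -1}. \<forall>n. \<forall>v\<in>D. P i \<sigma> n v x) \<and>
    (\<forall>w\<in>\<Pi>\<^sub>E i\<in>{..<k}. D. \<forall>j\<in>{..<k}. Q w j x)" if x: "x \<in> X" for x
  proof -
    have V: "closed (E i x)" "E i x \<noteq> {}" if "i < k" for i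
      using X(2)[OF x that] closed_subspace subspace_0 by blast+
    have "(\<forall>v\<in>E i x. norm (A x (\<sigma> * real n) *v v) \<le> c i \<sigma> n * norm v) \<longleftrightarrow> (\<forall>v\<in>D. P i \<sigma> n v x)" if "i < k" for i \<sigma> n
      using nonpos_on_closed_iff_dense[OF V[OF that] lip[OF c] D(2)] by (simp add: P_def)
    with projection_bound_iff_dense[OF V D(2) C] show ?thesis
      unfolding regular_at_def c_def[symmetric] Q_def by (simp add: Ball_def)
  qed
  then have "{x \<in> X. regular_at A k \<kappa> \<epsilon> E C x} = X \<inter> {x \<in> space N.
    (\<forall>i\<in>{..<k}. \<forall>\<sigma>\<in>{1, -1}. \<forall>n. \<forall>v\<in>D. P i \<sigma> n v x) \<and> (\<forall>w\<in>\<Pi>\<^sub>E i\<in>{..<k}. D. \<forall>j\<in>{..<k}. Q w j x)}"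
    using sets.sets_into_space[OF X(1)] by auto
  also have "\<dots> \<in> sets N"
  proof (intro sets.Int X(1) sets.sets_Collect_conj)
    have P: "Measurable.pred N (P i \<sigma> n v)" if "i < k" for i \<sigma> n v
    proof -
      have [measurable]: "(\<lambda>x. infdist v (E i x)) \<in> borel_measurable N"
        using E[OF that] .
      have "linear (\<lambda>B :: real ^ 'n ^ 'n. B *v v)"
        by (rule linearI) (simp_all add: matrix_vector_mult_add_rdistrib scaleR_matrix_vector_assoc)
      then have "(\<lambda>B :: real ^ 'n ^ 'n. B *v v) \<in> borel_measurable borel"
        by (intro borel_measurable_continuous_onI linear_continuous_on) (simp add: linear_conv_bounded_linear)
      then have [measurable]: "(\<lambda>x. A x t *v v) \<in> borel_measurable N" for t
        by (rule measurable_compose[OF A])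
      have [measurable]: "(\<lambda>x. matrix_norm (A x t)) \<in> borel_measurable N" for t
        by (rule measurable_compose[OF A matrix_norm_measurable])
      show ?thesis
        unfolding P_def by measurable
    qed
    have Q: "Measurable.pred N (Q w j)" for w j
    proof -
      have [measurable]: "(\<lambda>x. \<Sum>i<k. infdist (w i) (E i x)) \<in> borel_measurable N"
        using E by (intro borel_measurable_sum) auto
      show ?thesis
        unfolding Q_def by measurable
    qed
    have "Measurable.pred N (\<lambda>x. \<forall>i\<in>{..<k}. \<forall>\<sigma>\<in>{1, -1}. \<forall>n. \<forall>v\<in>D. P i \<sigma> n v x)"
      using D(1) P by (intro measurable_pred_countable(1) pred_intros_countable(1)) auto
    then show "{x \<in> space N. \<forall>i\<in>{..<k}. \<forall>\<sigma>\<in>{1, -1}. \<forall>n. \<forall>v\<in>D. P i \<sigma> n v x} \<in> sets N"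
      by (simp add: pred_def)
    have "Measurable.pred N (\<lambda>x. \<forall>w\<in>\<Pi>\<^sub>E i\<in>{..<k}. D. \<forall>j\<in>{..<k}. Q w j x)"
      using D(1) Q by (intro measurable_pred_countable(1) countable_PiE) auto
    then show "{x \<in> space N. \<forall>w\<in>\<Pi>\<^sub>E i\<in>{..<k}. D. \<forall>j\<in>{..<k}. Q w j x} \<in> sets N"
      by (simp add: pred_def)
  qed
  finally show ?thesis .
qed

section \<open>Large sets of regular points\<close>

lemma exp_log_plus_ge: "0 \<le> r \<Longrightarrow> r \<le> exp (log_plus r)"
  unfolding log_plus_def by (cases "r = 0") (metis exp_ge_zero, metis exp_le_cancel_iff exp_ln le_neq_trans max.cobounded1)

lemma log_plus_nonneg: "0 \<le> log_plus r"
  by (simp add: log_plus_def)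

lemma integrable_log_plus:
  fixes A :: "'a \<Rightarrow> real \<Rightarrow> real ^ 'n ^ 'n"
  assumes A: "(\<lambda>x. A x t) \<in> borel_measurable M" and int: "log_plus_integrable M A" and t: "t \<in> {-1..1}"
  shows "integrable M (\<lambda>x. log_plus (matrix_norm (A x t)))"
proof (rule integrableI_bounded)
  have "(\<lambda>x. matrix_norm (A x t)) \<in> borel_measurable M"
    by (rule measurable_compose[OF A matrix_norm_measurable])
  then show "(\<lambda>x. log_plus (matrix_norm (A x t))) \<in> borel_measurable M"
    unfolding log_plus_def by measurable
  have "(\<integral>\<^sup>+x. ennreal (norm (log_plus (matrix_norm (A x t)))) \<partial>M) \<le>
    (\<integral>\<^sup>+x. (SUP t\<in>{-1..1}. ennreal (log_plus (matrix_norm (A x t)))) \<partial>M)"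
    by (intro nn_integral_mono) (auto intro!: SUP_upper2[OF t] simp: log_plus_nonneg)
  also have "\<dots> < \<infinity>"
    using int by (simp add: log_plus_integrable_def nn_integral_completion)
  finally show "(\<integral>\<^sup>+x. ennreal (norm (log_plus (matrix_norm (A x t)))) \<partial>M) < \<infinity>" .
qed

text \<open>Integer constants exhaust \<open>X\<close> up to null sets, so dominated convergence
  applies. The complement is weighted by \<psi> because rare but large steps must be cheap as
  well.\<close>

lemma (in finite_measure) large_regular_set:
  fixes A :: "'a \<Rightarrow> real \<Rightarrow> real ^ 'n ^ 'n" and \<psi> :: "'a \<Rightarrow> real"
  assumes A: "\<And>t. (\<lambda>x. A x t) \<in> borel_measurable M" and inv: "\<And>x t. x \<in> space M \<Longrightarrow> invertible (A x t)"
    and E: "\<And>i v. i < k \<Longrightarrow> (\<lambda>x. infdist v (E i x)) \<in> borel_measurable (completion M)"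
    and X: "X \<in> sets M" "emeasure M (space M - X) = 0"
    and split: "\<And>x. x \<in> X \<Longrightarrow> direct_sum_splitting k (\<lambda>i. E i x)"
    and lim: "\<And>x i v. \<lbrakk>x \<in> X; i < k; v \<in> E i x - {0}\<rbrakk> \<Longrightarrow>
      ((\<lambda>t. 1 / t * ln (norm (A x t *v v))) \<longlongrightarrow> \<kappa> i) at_top \<and>
      ((\<lambda>t. 1 / t * ln (norm (A x t *v v))) \<longlongrightarrow> \<kappa> i) at_bot"
    and \<epsilon>: "0 < \<epsilon>" and \<psi>: "integrable M \<psi>" and e: "0 < e"
  obtains G C where "G \<in> sets M" "G \<subseteq> X" "0 < C" "\<And>x. x \<in> G \<Longrightarrow> regular_at A k \<kappa> \<epsilon> E C x"
    "(\<integral>x. indicator (- G) x * \<psi> x \<partial>M) < e"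
proof -
  define S where "S m = {x \<in> X. regular_at A k \<kappa> \<epsilon> E (real m) x}" for m :: nat
  have S: "S m \<in> sets (completion M)" for m
    unfolding S_def
  proof (rule regular_at_measurable)
    show "(\<lambda>x. A x t) \<in> borel_measurable (completion M)" for t
      using A by (rule measurable_completion)
    show "subspace (E i x)" if "x \<in> X" "i < k" for x i
      using split[OF that(1)] that(2) by (simp add: direct_sum_splitting_def)
  qed (use E X in auto)
  \<comment> \<open>\<open>main_part\<close> returns from the completion to sets of
    \<open>M\<close>. Its choices for different \<open>m\<close> need not be nested; the unions
    restore monotonicity.\<close>
  define G where "G n = (\<Union>m\<le>n. main_part M (S m))" for n :: nat
  have G_sets: "G n \<in> sets M" for n
    unfolding G_def using S by (intro sets.finite_UN) auto
  have main_S: "main_part M (S m) \<subseteq> S m" for m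
    using main_part_null_part_Un[OF S[of m]] by blast
  have G_reg: "x \<in> X \<and> regular_at A k \<kappa> \<epsilon> E (real (Suc n)) x" if x: "x \<in> G n" for x n
  proof -
    obtain m where m: "m \<le> n" "x \<in> main_part M (S m)"
      using x unfolding G_def by blast
    then have "x \<in> S m"
      using main_S by blast
    then have "x \<in> X" "regular_at A k \<kappa> \<epsilon> E (real m) x"
      by (simp_all add: S_def)
    then show ?thesis
      using m(1) by (simp add: regular_at_mono[of A k \<kappa> \<epsilon> E "real m"])
  qed
  have "AE x in M. x \<in> X"
    using X by (intro AE_I[of _ _ "space M - X"]) auto
  moreover have "AE x in M. \<forall>m. x \<notin> null_part M (S m)"
    unfolding AE_all_countable using AE_notin_null_part[OF S] by blast
  ultimately have AE_G: "AE x in M. \<exists>n. x \<in> G n"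
  proof eventually_elim
    case (elim x)
    have "x \<in> space M"
      using elim(1) sets.sets_into_space[OF X(1)] by blast
    from regular_at_exists[where A = A and x = x and E = E and \<kappa> = \<kappa>, OF inv[OF this] \<epsilon> split[OF elim(1)] lim[OF elim(1)]]
    obtain m :: nat where "regular_at A k \<kappa> \<epsilon> E (real m) x" .
    with elim(1) have "x \<in> S m"
      by (simp add: S_def)
    then have "x \<in> main_part M (S m)"
      using elim(2) main_part_null_part_Un[OF S[of m]] by blast
    then show ?case
      unfolding G_def by blast
  qed
  have "(\<lambda>n. \<integral>x. indicator (- G n) x * \<psi> x \<partial>M) \<longlonglongrightarrow> (\<integral>x. 0 \<partial>M)"
  proof (rule integral_dominated_convergence[where w = "\<lambda>x. \<bar>\<psi> x\<bar>"])
    show "AE x in M. (\<lambda>n. indicator (- G n) x * \<psi> x) \<longlonglongrightarrow> 0"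
      using AE_G
    proof eventually_elim
      case (elim x)
      then obtain n where n: "x \<in> G n" ..
      have "x \<in> G m" if "n \<le> m" for m
        using n that unfolding G_def by fastforce
      then have "eventually (\<lambda>m. indicator (- G m) x * \<psi> x = 0) sequentially"
        unfolding eventually_sequentially by (intro exI[of _ n]) auto
      then show ?case
        by (rule tendsto_eventually)
    qed
    show "(\<lambda>x. indicator (- G n) x * \<psi> x) \<in> borel_measurable M" for n
    proof -
      have "(\<lambda>x. indicator (space M - G n) x * \<psi> x) \<in> borel_measurable M"
        using G_sets \<psi> by measurable
      then show ?thesis
        by (rule measurable_cong[THEN iffD1, rotated]) (auto simp: indicator_def)
    qed
  qed (use \<psi> in \<open>auto simp: indicator_def\<close>)
  then have "eventually (\<lambda>n. (\<integral>x. indicator (- G n) x * \<psi> x \<partial>M) < e) sequentially"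
    using e by (intro order_tendstoD(2)) auto
  then obtain n where "(\<integral>x. indicator (- G n) x * \<psi> x \<partial>M) < e"
    by (auto simp: eventually_sequentially)
  with G_sets[of n] G_reg[where n = n] show ?thesis
    by (intro that[of "G n" "real (Suc n)"]) auto
qed

text \<open>The maximal inequality at threshold 1 / 2 costs twice the integral for each of the maps
  \<open>\<phi> 1\<close> and \<open>\<phi> (-1)\<close>, whence the factor 4.\<close>

lemma (in prob_space) seldom_bad_set:
  fixes \<phi> :: "real \<Rightarrow> 'a \<Rightarrow> 'a" and h :: "'a \<Rightarrow> real"
  assumes \<phi>: "\<And>t. \<phi> t \<in> measurable M M" "\<And>t. distr M M (\<phi> t) = M"
    and flow: "\<And>x. x \<in> space M \<Longrightarrow> \<phi> 0 x = x" "\<And>s t x. x \<in> space M \<Longrightarrow> \<phi> t (\<phi> s x) = \<phi> (t + s) x"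
    and h: "integrable M h" "\<And>x. x \<in> space M \<Longrightarrow> 0 \<le> h x"
  obtains Y where "Y \<in> sets M" "1 - 4 * (\<integral>x. h x \<partial>M) \<le> prob Y"
    "\<forall>x\<in>Y. \<forall>\<sigma>\<in>{1, -1}. \<forall>n. (\<Sum>l<n. h (\<phi> (\<sigma> * real l) x)) \<le> real n / 2"
proof -
  define B where "B \<sigma> = {x \<in> space M. \<exists>n. real n / 2 < (\<Sum>l<n. h (\<phi> (\<sigma> * real l) x))}" for \<sigma>
  have B: "B \<sigma> \<in> sets M" for \<sigma>
  proof -
    have [measurable]: "(\<lambda>x. h (\<phi> t x)) \<in> borel_measurable M" for t
      using \<phi>(1) borel_measurable_integrable[OF h(1)] by (rule measurable_compose)
    show ?thesis
      unfolding B_def by measurable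
  qed
  have "prob (B \<sigma>) \<le> 2 * (\<integral>x. h x \<partial>M)" for \<sigma>
  proof -
    have "(\<phi> \<sigma> ^^ l) x = \<phi> (\<sigma> * real l) x" if "x \<in> space M" for l x
      using that by (induction l) (simp_all add: flow algebra_simps)
    then have "B \<sigma> = {x \<in> space M. \<exists>n. 1 / 2 * real n < (\<Sum>l<n. h ((\<phi> \<sigma> ^^ l) x))}"
      unfolding B_def by (intro Collect_cong conj_cong refl) simp
    then show ?thesis
      using maximal_ergodic[OF \<phi> h, of "1 / 2" \<sigma>] by simp
  qed
  note B_le = this
  have "prob (B 1 \<union> B (-1)) \<le> 4 * (\<integral>x. h x \<partial>M)"
    using measure_Un_le[OF B[of 1] B[of "-1"]] B_le[of 1] B_le[of "-1"] by linarith
  then have "1 - 4 * (\<integral>x. h x \<partial>M) \<le> prob (space M - (B 1 \<union> B (-1)))"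
    using B by (subst prob_compl) auto
  moreover have "space M - (B 1 \<union> B (-1)) \<in> sets M"
    using B by blast
  moreover have "(\<Sum>l<n. h (\<phi> (\<sigma> * real l) x)) \<le> real n / 2"
    if "x \<in> space M - (B 1 \<union> B (-1))" "\<sigma> \<in> {1, -1}" for x \<sigma> n
    using that by (auto simp: B_def not_less)
  then have "\<forall>x\<in>space M - (B 1 \<union> B (-1)). \<forall>\<sigma>\<in>{1, -1}. \<forall>n. (\<Sum>l<n. h (\<phi> (\<sigma> * real l) x)) \<le> real n / 2"
    by blast
  ultimately show ?thesis
    by (intro that)
qed

text \<open>The inserted 1 keeps the minimum meaningful and positive when there is no pair of
  distinct exponents.\<close>

definition spectral_gap :: "real list \<Rightarrow> real" where
  "spectral_gap \<chi>s = Min (insert 1 ((\<lambda>(i, j). \<bar>\<chi>s ! j - \<chi>s ! i\<bar>) ` {(i, j). i < length \<chi>s \<and> j < length \<chi>s \<and> j \<noteq> i}))"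

lemma spectral_gap:
  assumes "sorted_wrt (<) \<chi>s"
  shows "0 < spectral_gap \<chi>s"
    and "\<lbrakk>i < length \<chi>s; j < length \<chi>s; j \<noteq> i\<rbrakk> \<Longrightarrow> spectral_gap \<chi>s \<le> \<bar>\<chi>s ! j - \<chi>s ! i\<bar>"
proof -
  let ?P = "{(i, j). i < length \<chi>s \<and> j < length \<chi>s \<and> j \<noteq> i}"
  have "finite ?P"
    by (rule finite_subset[of _ "{..<length \<chi>s} \<times> {..<length \<chi>s}"]) auto
  moreover have "\<chi>s ! j \<noteq> \<chi>s ! i" if "i < length \<chi>s" "j < length \<chi>s" "j \<noteq> i" for i j
    using sorted_wrt_nth_less[OF assms, of i j] sorted_wrt_nth_less[OF assms, of j i] that by fastforce
  ultimately show "0 < spectral_gap \<chi>s"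
    unfolding spectral_gap_def by (subst Min_gr_iff) auto
  show "spectral_gap \<chi>s \<le> \<bar>\<chi>s ! j - \<chi>s ! i\<bar>" if "i < length \<chi>s" "j < length \<chi>s" "j \<noteq> i"
    unfolding spectral_gap_def using that \<open>finite ?P\<close> by (intro Min_le) auto
qed

section \<open>Choice of the exponent and the final estimate\<close>

theorem corollary2:
  fixes M :: "'a::metric_space measure"
    and \<phi> :: "real \<Rightarrow> 'a \<Rightarrow> 'a"
    and \<nu> :: real
  assumes "sets M = sets borel"
    and "prob_space M"
    and "lebesgue_space M"
    and "measurable_flow M \<phi>"
    and "flow_invariant M \<phi>"
    and "flow_ergodic M \<phi>"
    and "\<forall>t. \<exists>L. L-lipschitz_on UNIV (\<phi> t)"
    and "\<nu> > 0"
  shows "\<exists>\<omega> :: real list \<Rightarrow> nat \<Rightarrow> real.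
    \<forall>(A :: 'a \<Rightarrow> real \<Rightarrow> real ^ 'n ^ 'n) (\<chi>s :: real list) (E :: nat \<Rightarrow> 'a \<Rightarrow> (real ^ 'n) set).
      linear_cocycle M \<phi> A \<and> holder_cocycle \<nu> A \<and> log_plus_integrable M A \<and>
      oseledets_splitting M \<phi> A \<chi>s E \<longrightarrow>
        (\<forall>i<length \<chi>s. \<omega> \<chi>s i \<in> {0<..<1}) \<and>
        (\<forall>\<epsilon>>0. \<exists>\<Lambda> C \<delta>. compact \<Lambda> \<and> C > 0 \<and> \<delta> > 0 \<and>
           measure M \<Lambda> \<ge> 1 - \<epsilon> \<and>
           (\<forall>i<length \<chi>s. \<forall>x\<in>\<Lambda>. \<forall>y\<in>\<Lambda>. dist x y < \<delta> \<longrightarrow>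
              subspace_dist (E i x) (E i y) \<le> C * dist x y powr (\<nu> * \<omega> \<chi>s i)))"
proof -
  interpret prob_space M by fact
  have space_M: "space M = UNIV"
    using sets_eq_imp_space_eq[OF assms(1)] by simp
  have flow: "\<phi> 0 x = x" "\<phi> t (\<phi> s x) = \<phi> (t + s) x" for s t x
    using assms(4) by (auto simp: measurable_flow_def space_M)
  have \<phi>: "\<phi> t \<in> measurable M M" "distr M M (\<phi> t) = M" for t
  proof -
    have "(\<lambda>x. (t, x)) \<in> measurable M (borel \<Otimes>\<^sub>M M)"
      by simp
    from measurable_compose[OF this] show "\<phi> t \<in> measurable M M"
      using assms(4) by (fastforce simp: measurable_flow_def)
    show "distr M M (\<phi> t) = M"
      using assms(5) by (simp add: flow_invariant_def)
  qed
  obtain L1 L2 where L12: "L1-lipschitz_on UNIV (\<phi> 1)" "L2-lipschitz_on UNIV (\<phi> (-1))"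
    using assms(7) by blast
  \<comment> \<open>Only the maps at times 1 and -1 are iterated. The lower bound 1 makes
    \<open>ln L\<close> nonnegative and \<open>L ^ m\<close> nondecreasing in
    \<open>m\<close>.\<close>
  define L where "L = max 1 (max L1 L2)"
  have lip: "dist (\<phi> \<sigma> x) (\<phi> \<sigma> y) \<le> L * dist x y" if "\<sigma> \<in> {1, -1}" for \<sigma> x y
  proof -
    have "dist (\<phi> \<sigma> x) (\<phi> \<sigma> y) \<le> (if \<sigma> = 1 then L1 else L2) * dist x y"
      using that lipschitz_onD[OF L12(1), of x y] lipschitz_onD[OF L12(2), of x y] by auto
    also have "\<dots> \<le> L * dist x y"
      by (intro mult_right_mono) (auto simp: L_def)
    finally show ?thesis .
  qed
  \<comment> \<open>The constant of the locale is taken outside of any interpretation, so that for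
    the given flow and \<nu> it is a function of the exponents, fixed before \<open>A\<close>. A
    quarter of the gap is what \<open>component_bound\<close> asks for.\<close>
  define \<theta> where "\<theta> \<chi>s = regular_block.\<omega> (length \<chi>s) ((!) \<chi>s) (spectral_gap \<chi>s / 4) L \<nu>" for \<chi>s
  have main: "0 < \<theta> \<chi>s \<and> \<theta> \<chi>s < 1 \<and> (\<exists>\<Lambda> C. compact \<Lambda> \<and> C > 0 \<and> measure M \<Lambda> \<ge> 1 - e \<and>
      (\<forall>i<length \<chi>s. \<forall>x\<in>\<Lambda>. \<forall>y\<in>\<Lambda>. dist x y < 1 \<longrightarrow>
         subspace_dist (E i x) (E i y) \<le> C * dist x y powr (\<nu> * \<theta> \<chi>s)))"
    if co: "linear_cocycle M \<phi> A" and hol: "holder_cocycle \<nu> A" and int: "log_plus_integrable M A"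
      and os: "oseledets_splitting M \<phi> A \<chi>s E" and e: "0 < e"
    for A :: "'a \<Rightarrow> real \<Rightarrow> real ^ 'n ^ 'n" and \<chi>s E e
  proof -
    let ?k = "length \<chi>s" and ?\<epsilon> = "spectral_gap \<chi>s / 4"
    have gap: "0 < spectral_gap \<chi>s"
      "\<And>i j. \<lbrakk>i < ?k; j < ?k; j \<noteq> i\<rbrakk> \<Longrightarrow> spectral_gap \<chi>s \<le> \<bar>\<chi>s ! j - \<chi>s ! i\<bar>"
      using os spectral_gap by (auto simp: oseledets_splitting_def)
    have A_meas: "(\<lambda>x. A x t) \<in> borel_measurable M" for t
    proof -
      have "(\<lambda>x. (x, t)) \<in> measurable M (M \<Otimes>\<^sub>M borel)"
        by simp
      from measurable_compose[OF this] show ?thesis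
        using co by (fastforce simp: linear_cocycle_def)
    qed
    obtain H1 H2 where H12: "H1 > 0" "\<And>x y. matrix_norm (A x 1 - A y 1) \<le> H1 * dist x y powr \<nu>"
      "H2 > 0" "\<And>x y. matrix_norm (A x (-1) - A y (-1)) \<le> H2 * dist x y powr \<nu>"
      using hol unfolding holder_cocycle_def by metis
    define H where "H = max H1 H2"
    have holder: "matrix_norm (A x \<sigma> - A y \<sigma>) \<le> H * dist x y powr \<nu>" if "\<sigma> \<in> {1, -1}" for \<sigma> x y
    proof -
      have "matrix_norm (A x \<sigma> - A y \<sigma>) \<le> (if \<sigma> = 1 then H1 else H2) * dist x y powr \<nu>"
        using that H12 by auto
      also have "\<dots> \<le> H * dist x y powr \<nu>"
        by (intro mult_right_mono) (auto simp: H_def)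
      finally show ?thesis .
    qed
    define R where "R x \<longleftrightarrow> direct_sum_splitting ?k (\<lambda>i. E i x) \<and>
       (\<forall>i<?k. E i x \<noteq> {0} \<and> (\<forall>t. (*v) (A x t) ` E i x = E i (\<phi> t x)) \<and>
          (\<forall>v\<in>E i x - {0}.
             ((\<lambda>t. 1 / t * ln (norm (A x t *v v))) \<longlongrightarrow> \<chi>s ! i) at_top \<and>
             ((\<lambda>t. 1 / t * ln (norm (A x t *v v))) \<longlongrightarrow> \<chi>s ! i) at_bot))" for x
    have "AE x in M. R x"
      using os unfolding oseledets_splitting_def R_def by blast
    then obtain N where N: "{x \<in> space M. \<not> R x} \<subseteq> N" "emeasure M N = 0" "N \<in> sets M"
      by (rule AE_E)
    have R: "R x" if "x \<in> space M - N" for x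
      using N(1) that by blast
    \<comment> \<open>The 1 pays for the visit as such, the other summands for one step in either
      direction of time.\<close>
    define \<psi> where "\<psi> x = 1 + log_plus (matrix_norm (A x 1)) + log_plus (matrix_norm (A x (-1)))" for x
    have \<psi>: "integrable M \<psi>" "1 \<le> \<psi> x" for x
      unfolding \<psi>_def using integrable_log_plus[OF A_meas int] log_plus_nonneg by (auto intro!: add_nonneg_nonneg)
    have \<psi>_step: "matrix_norm (A x \<sigma>) \<le> exp (\<psi> x)" if "\<sigma> \<in> {1, -1}" for x \<sigma>
    proof -
      have "matrix_norm (A x \<sigma>) \<le> exp (log_plus (matrix_norm (A x \<sigma>)))"
        by (intro exp_log_plus_ge matrix_norm_pos)
      also have "\<dots> \<le> exp (\<psi> x)"
        using that log_plus_nonneg[of "matrix_norm (A x 1)"] log_plus_nonneg[of "matrix_norm (A x (-1))"] by (auto simp: \<psi>_def)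
      finally show ?thesis .
    qed
    \<comment> \<open>The exceptional orbits have measure at most 4 times this integral, hence at
      most e / 2; the other half is left for the compact subset.\<close>
    obtain G C where G: "G \<in> sets M" "G \<subseteq> space M - N" "0 < C"
      "\<And>x. x \<in> G \<Longrightarrow> regular_at A ?k ((!) \<chi>s) ?\<epsilon> E C x" "(\<integral>x. indicator (- G) x * \<psi> x \<partial>M) < e / 8"
    proof (rule large_regular_set[where A = A and k = ?k and E = E and X = "space M - N" and \<kappa> = "(!) \<chi>s"
          and \<epsilon> = ?\<epsilon> and \<psi> = \<psi> and e = "e / 8"])
      show "invertible (A x t)" if "x \<in> space M" for x t
        using co that by (simp add: linear_cocycle_def)
      show "(\<lambda>x. infdist v (E i x)) \<in> borel_measurable (completion M)" if "i < ?k" for i v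
        using os that by (simp add: oseledets_splitting_def)
      show "emeasure M (space M - (space M - N)) = 0"
        using N(2,3) sets.sets_into_space[OF N(3)] by (simp add: double_diff)
      show "direct_sum_splitting ?k (\<lambda>i. E i x)" if "x \<in> space M - N" for x
        using R[OF that] by (simp add: R_def)
      show "((\<lambda>t. 1 / t * ln (norm (A x t *v v))) \<longlongrightarrow> \<chi>s ! i) at_top \<and>
        ((\<lambda>t. 1 / t * ln (norm (A x t *v v))) \<longlongrightarrow> \<chi>s ! i) at_bot"
        if "x \<in> space M - N" "i < ?k" "v \<in> E i x - {0}" for x i v
        using R[OF that(1)] that(2,3) unfolding R_def by blast
    qed (use A_meas N(3) gap(1) \<psi>(1) e in auto)
    define h where "h x = indicator (- G) x * \<psi> x" for x
    have "integrable M (\<lambda>x. indicator (- G) x *\<^sub>R \<psi> x)"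
      using G(1) sets.compl_sets[OF G(1)] by (intro integrable_mult_indicator \<psi>) (simp add: space_M Compl_eq_Diff_UNIV)
    then have h: "integrable M h" "0 \<le> h x" for x
      using order_trans[OF zero_le_one \<psi>(2)[of x]] by (simp_all add: h_def[abs_def])
    interpret regular_block \<phi> A ?k "(!) \<chi>s" E G h C ?\<epsilon> H L \<nu>
    proof
      fix x :: 'a and i :: nat and \<sigma> :: real
      show "A x 0 = mat 1" "A x (t + s) = A (\<phi> t x) s ** A x t" for s t
        using co by (simp_all add: linear_cocycle_def space_M)
      show "direct_sum_splitting ?k (\<lambda>i. E i x)" if "x \<in> G"
        using R[of x] G(2) that unfolding R_def by blast
      show "E i x \<noteq> {0}" "(*v) (A x t) ` E i x = E i (\<phi> t x)" if "x \<in> G" "i < ?k" for t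
        using R[of x] G(2) that unfolding R_def by blast+
      show "norm (A x (\<sigma> * real n) *v v) \<le> C * exp ((\<sigma> * \<chi>s ! i + ?\<epsilon>) * real n) * norm v"
        if "x \<in> G" "i < ?k" "v \<in> E i x" "\<sigma> \<in> {1, -1}" for n v
        using G(4)[OF that(1)] that unfolding regular_at_def by blast
      show "norm (w i) \<le> C * norm (\<Sum>i<?k. w i)" if "x \<in> G" "w \<in> (\<Pi>\<^sub>E i\<in>{..<?k}. E i x)" "i < ?k" for w
        using G(4)[OF that(1)] that unfolding regular_at_def by blast
      show "1 \<le> h x" if "x \<notin> G"
        using \<psi>(2) that by (simp add: h_def)
      show "matrix_norm (A x \<sigma>) \<le> exp (h x)" if "x \<notin> G" "\<sigma> \<in> {1, -1}"
        using \<psi>_step that by (simp add: h_def)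
    qed (use flow holder lip G(3) H12 assms(8) gap(1) h in \<open>auto simp: H_def L_def\<close>)
    obtain Y where Y: "Y \<in> sets M" "1 - 4 * (\<integral>x. h x \<partial>M) \<le> prob Y"
      "\<forall>x\<in>Y. \<forall>\<sigma>\<in>{1, -1}. \<forall>n. (\<Sum>l<n. h (\<phi> (\<sigma> * real l) x)) \<le> real n / 2"
      by (rule seldom_bad_set[OF \<phi> flow h])
    have seldom: "seldom_bad x" if "x \<in> Y" for x
      unfolding seldom_bad_def using Y(3) that by simp
    obtain K where K: "compact K" "K \<subseteq> Y" "prob Y \<le> prob K + e / 2"
      using tight_lebesgue_space[OF assms(1) finite_measure_axioms assms(3) Y(1), of "e / 2"] e by auto
    have "1 - e \<le> prob K"
      using Y(2) K(3) G(5) by (simp add: h_def[abs_def])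
    \<comment> \<open>\<open>C2\<close> vanishes for an empty list of exponents, while the constant
      has to be positive.\<close>
    moreover have "subspace_dist (E i x) (E i y) \<le> (C2 + 1) * dist x y powr (\<nu> * \<omega>)"
      if "i < ?k" "x \<in> K" "y \<in> K" "dist x y < 1" for i x y
    proof -
      have "subspace_dist (E i x) (E i y) \<le> C2 * dist x y powr (\<nu> * \<omega>)"
        using that K(2) seldom gap(2) by (intro subspace_dist_bound) auto
      also have "\<dots> \<le> (C2 + 1) * dist x y powr (\<nu> * \<omega>)"
        by (intro mult_right_mono) auto
      finally show ?thesis .
    qed
    ultimately show ?thesis
      using K(1) C2_nonneg \<omega>_bounds unfolding \<theta>_def
      by (intro conjI exI[of _ K] exI[of _ "C2 + 1"]) auto
  qed
  show ?thesis
  proof (intro exI[of _ "\<lambda>\<chi>s i. \<theta> \<chi>s"] allI impI conjI; elim conjE)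
    fix A :: "'a \<Rightarrow> real \<Rightarrow> real ^ 'n ^ 'n" and \<chi>s E and i :: nat
    assume "linear_cocycle M \<phi> A" "holder_cocycle \<nu> A" "log_plus_integrable M A" "oseledets_splitting M \<phi> A \<chi>s E"
    note main = main[OF this]
    \<comment> \<open>The bounds on \<theta> come from the interpretation inside
      \<open>main\<close>, which is made for some accuracy; the value 1 is arbitrary.\<close>
    show "\<theta> \<chi>s \<in> {0<..<1}"
      using main[of 1] by simp
    show "\<exists>\<Lambda> C \<delta>. compact \<Lambda> \<and> C > 0 \<and> \<delta> > 0 \<and> measure M \<Lambda> \<ge> 1 - \<epsilon> \<and>
           (\<forall>i<length \<chi>s. \<forall>x\<in>\<Lambda>. \<forall>y\<in>\<Lambda>. dist x y < \<delta> \<longrightarrow>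
              subspace_dist (E i x) (E i y) \<le> C * dist x y powr (\<nu> * \<theta> \<chi>s))" if "0 < \<epsilon>" for \<epsilon>
      using main[OF that] zero_less_one[where 'a = real] by blast
  qed
qed

end
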